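(* Let $T$ be an aperiodic countable-to-one measure-preserving Borel transformation on a standard probability space $(X,\mu)$, with $T$ surjective and $E_T$ null-preserving, let $\rho$ be the Radon--Nikodym cocycle of $E_T$ with respect to $\mu$, and let $\Gamma$ be a countable complete set of Borel partial right inverses of $T$. Let $c>0$ and let $(\tau_n)$ be any sequence of trees in $\mathcal{T}_\Gamma$ that are $c$-fat for $\rho$ and such that $h(\tau_n)\to\infty$ as $n\to\infty$. Then for any $1\le p<\infty$ and $f\in L^p(X,\mu)$, \[ \lim_{n\to\infty}\widehat{\tau}_nf=\overline{f}\quad\text{a.e. and in }L^p, \] where $\overline{f}$ is the conditional expectation of $f$ with respect to the $\sigma$-algebra of $T$-invariant Borel sets.
   Context: $\mathbb{N}$ includes $0$. $T$ is aperiodic if $T^n(x)\ne x$ for all $x\in X$, $n\ge1$; countable-to-one if all $T^{-1}(x)$ are countable. $x\,E_T\,y$ iff $T^n(x)=T^m(y)$ for some $n,m\in\mathbb{N}$. A countable Borel equivalence relation $E$ on $(X,\mu)$ is null-preserving if for every partial Borel injection $\gamma$ on $X$ with graph contained in $E$, $\mathrm{dom}(\gamma)$ is null iff $\mathrm{im}(\gamma)$ is null. (Surjectivity of $T$ and $E_T$ null-preserving can be arranged by discarding a null set and are a standing convention.) The Radon--Nikodym cocycle of $E$ with respect to $\mu$ is the a.e. unique Borel function $\rho:E\to\mathbb{R}^+$, $(x,y)\mapsto\rho_x(y)$, with $\rho_x(y)\rho_y(z)=\rho_x(z)$ and $\int_{\mathrm{im}(\gamma)}h\,d\mu=\int_{\mathrm{dom}(\gamma)}h(\gamma(x))\rho_x(\gamma(x))\,d\mu(x)$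 for all $h\in L^1(X,\mu)$ and all partial Borel injections $\gamma$ with graph contained in $E$. A set $\Gamma$ of Borel partial functions $X\rightharpoonup X$ is a complete set of Borel partial right inverses of $T$ if the graphs of its members are pairwise disjoint and $T^{-1}(x)=\{\gamma(x):\gamma\in\Gamma,\ x\in\mathrm{dom}(\gamma)\}$ for each $x\in X$. A word $t=\gamma_1\gamma_2\cdots\gamma_n$ in $\Gamma$ is viewed as the partial function $t(x)=\gamma_1(\gamma_2(\cdots\gamma_n(x)))$, defined where all compositions are; the empty word is the identity. For a set $J$ of finite words in $\Gamma$, $J\cdot x:=\{t(x):t\in J,\ x\in\mathrm{dom}(t)\}$, $\rho_x(J\cdot x):=\sum_{y\in J\cdot x}\rho_x(y)$ and $\widehat{J}f(x):=\frac{1}{\rho_x(J\cdot x)}\sum_{y\in J\cdot x}f(y)\rho_x(y)$. $\mathcal{T}_\Gamma$ is the set of sets $\tau$ of finite words in $\Gamma$ that have bounded length, contain the empty word, and satisfy: $t_1t_2\in\tau$ implies $t_2\in\tau$. The height $h(\tau)$ is the least $n$ such that all words in $\tau$ have length at most $n$. A tree $\tau\in\mathcal{T}_\Gamma$ is $c$-fat for $\rho$ if $\frac{\rho_x(\tau\cdot x)}{h(\tau)+1}\ge c$ for a.e. $x\in X$. *)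

theory Defs
  imports "HOL-Probability.Probability"
begin

section \<open>Standard Borel spaces and \<open>L\<^sup>p\<close>\<close>

definition standard_borel :: "'a measure \<Rightarrow> bool" where
  "standard_borel M \<longleftrightarrow>
     (\<exists>X. completely_metrizable_space X \<and> second_countable X \<and>
          space M = topspace X \<and> sets M = sigma_sets (topspace X) {U. openin X U})"

definition Lp :: "'a measure \<Rightarrow> real \<Rightarrow> ('a \<Rightarrow> real) set" where
  "Lp M p = {f \<in> borel_measurable M. integrable M (\<lambda>x. \<bar>f x\<bar> powr p)}"

definition Lp_norm :: "'a measure \<Rightarrow> real \<Rightarrow> ('a \<Rightarrow> real) \<Rightarrow> real" where
  "Lp_norm M p f = (LINT x|M. \<bar>f x\<bar> powr p) powr (1 / p)"

definition tendsto_Lp ::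
  "'a measure \<Rightarrow> real \<Rightarrow> (nat \<Rightarrow> 'a \<Rightarrow> real) \<Rightarrow> ('a \<Rightarrow> real) \<Rightarrow> bool" where
  "tendsto_Lp M p F g \<longleftrightarrow>
     (\<forall>n. F n \<in> Lp M p) \<and> g \<in> Lp M p \<and>
     (\<lambda>n. Lp_norm M p (\<lambda>x. F n x - g x)) \<longlonglongrightarrow> 0"


section \<open>Borel transformations\<close>

definition measure_preserving_map :: "'a measure \<Rightarrow> ('a \<Rightarrow> 'a) \<Rightarrow> bool" where
  "measure_preserving_map M T \<longleftrightarrow> T \<in> measurable M M \<and> distr M M T = M"

definition aperiodic :: "'a measure \<Rightarrow> ('a \<Rightarrow> 'a) \<Rightarrow> bool" where
  "aperiodic M T \<longleftrightarrow> (\<forall>x\<in>space M. \<forall>n\<ge>1. (T ^^ n) x \<noteq> x)"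

definition countable_to_one :: "'a measure \<Rightarrow> ('a \<Rightarrow> 'a) \<Rightarrow> bool" where
  "countable_to_one M T \<longleftrightarrow> (\<forall>x\<in>space M. countable (T -` {x} \<inter> space M))"

definition orbit_rel :: "'a measure \<Rightarrow> ('a \<Rightarrow> 'a) \<Rightarrow> ('a \<times> 'a) set" where
  "orbit_rel M T = {(x, y). x \<in> space M \<and> y \<in> space M \<and> (\<exists>n m. (T ^^ n) x = (T ^^ m) y)}"

definition invariant_algebra :: "'a measure \<Rightarrow> ('a \<Rightarrow> 'a) \<Rightarrow> 'a measure" where
  "invariant_algebra M T = sigma (space M) {A \<in> sets M. T -` A \<inter> space M = A}"


section \<open>Partial Borel maps and the Radon--Nikodym cocycle\<close>

text \<open>
  As usual in descriptive set theory, the domain of a Borel partial function is Borel. The image of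
  a Borel partial injection of a standard Borel space is then Borel as well (Lusin--Souslin), so
  this is not part of the definition.
\<close>

definition borel_partial :: "'a measure \<Rightarrow> ('a \<rightharpoonup> 'a) \<Rightarrow> bool" where
  "borel_partial M \<gamma> \<longleftrightarrow>
     dom \<gamma> \<in> sets M \<and> (\<lambda>x. the (\<gamma> x)) \<in> measurable (restrict_space M (dom \<gamma>)) M"

definition borel_partial_injection_in :: "'a measure \<Rightarrow> ('a \<times> 'a) set \<Rightarrow> ('a \<rightharpoonup> 'a) \<Rightarrow> bool" where
  "borel_partial_injection_in M E \<gamma> \<longleftrightarrow>
     borel_partial M \<gamma> \<and> inj_on \<gamma> (dom \<gamma>) \<and> Map.graph \<gamma> \<subseteq> E"

definition null_preserving :: "'a measure \<Rightarrow> ('a \<times> 'a) set \<Rightarrow> bool" where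
  "null_preserving M E \<longleftrightarrow>
     (\<forall>\<gamma>. borel_partial_injection_in M E \<gamma> \<longrightarrow> (dom \<gamma> \<in> null_sets M \<longleftrightarrow> ran \<gamma> \<in> null_sets M))"

text \<open>
  \<open>\<rho> x y\<close> stands for \<open>\<rho>\<^sub>x(y)\<close>; only its values on \<open>E\<close> matter. Integrability of the
  right-hand integrand is stated explicitly because the Bochner integral of a non-integrable
  function is \<open>0\<close>.
\<close>

definition radon_nikodym_cocycle ::
  "'a measure \<Rightarrow> ('a \<times> 'a) set \<Rightarrow> ('a \<Rightarrow> 'a \<Rightarrow> real) \<Rightarrow> bool" where
  "radon_nikodym_cocycle M E \<rho> \<longleftrightarrow>
     (\<lambda>(x, y). \<rho> x y) \<in> borel_measurable (restrict_space (M \<Otimes>\<^sub>M M) E) \<and>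
     (\<forall>(x, y)\<in>E. \<rho> x y > 0) \<and>
     (\<forall>x y z. (x, y) \<in> E \<longrightarrow> (y, z) \<in> E \<longrightarrow> \<rho> x y * \<rho> y z = \<rho> x z) \<and>
     (\<forall>\<gamma> h. borel_partial_injection_in M E \<gamma> \<longrightarrow> integrable M h \<longrightarrow>
        set_integrable M (dom \<gamma>) (\<lambda>x. h (the (\<gamma> x)) * \<rho> x (the (\<gamma> x))) \<and>
        (LINT y:ran \<gamma>|M. h y) = (LINT x:dom \<gamma>|M. h (the (\<gamma> x)) * \<rho> x (the (\<gamma> x))))"


section \<open>Right inverses, words and trees\<close>

definition complete_right_inverses ::
  "'a measure \<Rightarrow> ('a \<Rightarrow> 'a) \<Rightarrow> ('a \<rightharpoonup> 'a) set \<Rightarrow> bool" where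
  "complete_right_inverses M T \<Gamma> \<longleftrightarrow>
     (\<forall>\<gamma>\<in>\<Gamma>. borel_partial M \<gamma>) \<and>
     pairwise (\<lambda>\<gamma> \<delta>. disjnt (Map.graph \<gamma>) (Map.graph \<delta>)) \<Gamma> \<and>
     (\<forall>x\<in>space M. T -` {x} \<inter> space M = {y. \<exists>\<gamma>\<in>\<Gamma>. \<gamma> x = Some y})"

definition word_map :: "('a \<rightharpoonup> 'a) list \<Rightarrow> ('a \<rightharpoonup> 'a)" where
  "word_map t = foldr (\<circ>\<^sub>m) t Some"

definition word_orbit :: "('a \<rightharpoonup> 'a) list set \<Rightarrow> 'a \<Rightarrow> 'a set" where
  "word_orbit J x = {y. \<exists>t\<in>J. word_map t x = Some y}"

text \<open>
  \<open>word_orbit J x\<close> can be infinite, so its weight is an extended nonnegative real. In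
  \<open>word_average\<close> an infinite weight gives \<open>0\<close>, in accordance with \<open>1 / \<infinity> = 0\<close>.
\<close>

definition weight :: "('a \<Rightarrow> 'a \<Rightarrow> real) \<Rightarrow> 'a \<Rightarrow> 'a set \<Rightarrow> ennreal" where
  "weight \<rho> x A = (\<Sum>\<^sub>\<infinity>y\<in>A. ennreal (\<rho> x y))"

definition word_average ::
  "('a \<Rightarrow> 'a \<Rightarrow> real) \<Rightarrow> ('a \<rightharpoonup> 'a) list set \<Rightarrow> ('a \<Rightarrow> real) \<Rightarrow> 'a \<Rightarrow> real" where
  "word_average \<rho> J f x =
     1 / enn2real (weight \<rho> x (word_orbit J x)) * (\<Sum>\<^sub>\<infinity>y\<in>word_orbit J x. f y * \<rho> x y)"

definition trees :: "('a \<rightharpoonup> 'a) set \<Rightarrow> ('a \<rightharpoonup> 'a) list set set" where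
  "trees \<Gamma> = {\<tau>. \<tau> \<subseteq> lists \<Gamma> \<and> (\<exists>n. \<forall>t\<in>\<tau>. length t \<le> n) \<and> [] \<in> \<tau> \<and>
                 (\<forall>t\<^sub>1 t\<^sub>2. t\<^sub>1 @ t\<^sub>2 \<in> \<tau> \<longrightarrow> t\<^sub>2 \<in> \<tau>)}"

definition height :: "('a \<rightharpoonup> 'a) list set \<Rightarrow> nat" where
  "height \<tau> = (LEAST n. \<forall>t\<in>\<tau>. length t \<le> n)"

definition fat :: "'a measure \<Rightarrow> ('a \<Rightarrow> 'a \<Rightarrow> real) \<Rightarrow> real \<Rightarrow> ('a \<rightharpoonup> 'a) list set \<Rightarrow> bool" where
  "fat M \<rho> c \<tau> \<longleftrightarrow>
     (AE x in M. weight \<rho> x (word_orbit \<tau> x) / of_nat (height \<tau> + 1) \<ge> ennreal c)"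

end

theory Submission
  imports Defs
begin

text \<open>
  Write $P f(x) = \sum_{T y = x} f(y) \rho_x(y)$ for the transfer operator. The change of variables
  formula of the cocycle gives $\int P f = \int f$, and invariance of the measure gives $P 1 = 1$.
  By the cocycle identity $P^k f(x)$ is the weighted sum of $f$ over $T^{-k}(x)$, so the weighted
  sum of $f \geq 0$ over a tree of height $h$ is at most $\sum_{k \leq h} P^k f(x)$.

  The heart of the proof is a telescoping argument (\<open>wsum_shift_le\<close>, \<open>rsum_coboundary_bound\<close>).
  Let $S$ be a tree orbit with root $x$. In $\sum_{y \in S} \rho_x(y) (g(y) - g(T y))$ every
  vertex $z$ receives the coefficient $\rho_x(z) - \rho_x(S \cap T^{-1}(z))$, apart from a
  contribution $-g(T x)$ of the root. For almost every $x$ these coefficients are nonnegative,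
  because $P 1 = 1$ at almost every point and hence along almost every backward orbit; they add up
  to $\rho_x(x) = 1$ because every vertex other than the root is a child of exactly one vertex. So
  the sum is at most $2 \sup |g|$ in absolute value, whatever the tree is, and averages of
  bounded coboundaries $g - g \circ T$ tend to $0$ as soon as the weights of the trees tend to
  infinity, which fatness and the growth of the heights guarantee. An invariant function is averaged
  to itself.

  Invariant functions and bounded coboundaries are dense in $L^1$ in the sense that
  $f = \overline{f} + (g - g \circ T) + r$ with $r$ small in $L^1$
  (\<open>invariant_plus_coboundary_dense\<close>); this comes from the Birkhoff theorem for bounded functions.
  Fatness bounds the tree averages of $|r|$ by $c^{-1} \sup_n n^{-1} \sum_{k < n} P^k |r|$, which
  is small outside a set of small measure by the maximal inequality for $P$. This
  yields convergence almost everywhere. One maximal inequality for positive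
  contractions (\<open>hopf_maximal_inequality\<close>) serves twice: for the Koopman operator in the Birkhoff
  theorem and for $P$ here.

  For convergence in $L^p$, fatness and Jensen's inequality give
  $\| \widehat{\tau}_n f \|_p^p \leq c^{-1} \| f \|_p^p$, and by Fatou's lemma the same bound holds
  for $\overline{f}$. Truncation then reduces the claim to bounded functions, where it follows from
  almost everywhere convergence by dominated convergence.
\<close>

section \<open>Sums as integrals over counting measures\<close>

text \<open>
  Weights and averages are unordered sums. Seen as integrals over counting measures they are open
  to Fubini's theorem and to the convergence theorems.
\<close>
lemma infsum_ennreal_conv_nn_integral:
  fixes f :: "'a \<Rightarrow> ennreal"
  assumes "countable A"
  shows "infsum f A = (\<integral>\<^sup>+y. f y \<partial>count_space A)"
proof -
  have eq: "infsum f A = (SUP F\<in>{F. finite F \<and> F \<subseteq> A}. sum f F)"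
    by (rule nonneg_infsum_complete) auto
  have sum_eq: "sum f F = (\<integral>\<^sup>+y. f y * indicator F y \<partial>count_space A)"
    if "finite F" "F \<subseteq> A" for F
    using that by (subst nn_integral_count_space'[where A = F])
      (auto simp: indicator_def intro!: sum.cong)
  have sum_le: "sum f F \<le> (\<integral>\<^sup>+y. f y \<partial>count_space A)" if "finite F" "F \<subseteq> A" for F
    unfolding sum_eq[OF that] by (intro nn_integral_mono) (auto simp: indicator_def)
  show ?thesis
  proof (rule antisym)
    show "infsum f A \<le> (\<integral>\<^sup>+y. f y \<partial>count_space A)"
      unfolding eq using sum_le by (auto intro!: SUP_least)
  next
    define G where "G n = A \<inter> (from_nat_into A ` {..n})" for n
    have G: "finite (G n)" "G n \<subseteq> A" for n by (auto simp: G_def)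
    have "(\<integral>\<^sup>+y. f y \<partial>count_space A) = (\<integral>\<^sup>+y. (SUP n. f y * indicator (G n) y) \<partial>count_space A)"
    proof (rule nn_integral_cong)
      fix y assume "y \<in> space (count_space A)"
      then have y: "y \<in> A" by simp
      have "y \<in> G (to_nat_on A y)"
        using y assms unfolding G_def by (auto intro!: image_eqI[where x = "to_nat_on A y"])
      then have "f y \<le> (SUP n. f y * indicator (G n) y)"
        by (intro SUP_upper2[where i = "to_nat_on A y"]) auto
      moreover have "(SUP n. f y * indicator (G n) y) \<le> f y"
        by (intro SUP_least) (auto simp: indicator_def)
      ultimately show "f y = (SUP n. f y * indicator (G n) y)" by (rule antisym)
    qed
    also have "\<dots> = (SUP n. \<integral>\<^sup>+y. f y * indicator (G n) y \<partial>count_space A)"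
      by (intro nn_integral_monotone_convergence_SUP)
         (auto simp: incseq_def le_fun_def G_def indicator_def)
    also have "\<dots> = (SUP n. sum f (G n))"
      using sum_eq[OF G] by simp
    also have "\<dots> \<le> infsum f A"
      unfolding eq using G by (auto intro!: SUP_least SUP_upper)
    finally show "(\<integral>\<^sup>+y. f y \<partial>count_space A) \<le> infsum f A" .
  qed
qed

text \<open>For real functions both sides are \<open>0\<close> unless the sum converges absolutely.\<close>
lemma infsum_real_conv_integral:
  fixes f :: "'a \<Rightarrow> real"
  shows "infsum f A = (LINT y|count_space A. f y)"
proof (cases "f summable_on A")
  case True
  then have "Infinite_Set_Sum.abs_summable_on f A"
    using abs_summable_equivalent[of f A] summable_on_iff_abs_summable_on_real[of f A] by simp
  then show ?thesis using infsetsum_infsum[of f A] by (simp add: infsetsum_def)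
next
  case False
  then have "\<not> integrable (count_space A) f"
    using abs_summable_equivalent[of f A] summable_on_iff_abs_summable_on_real[of f A]
    by (simp add: Infinite_Set_Sum.abs_summable_on_def)
  then show ?thesis using False
    by (simp add: infsum_not_exists not_integrable_integral_eq)
qed

text \<open>
  Fubini's theorem for the pairs \<open>(\<phi> y, y)\<close>. With \<open>\<phi>\<close> an iterate of \<open>T\<close> it regroups a sum over
  descendants by their ancestors.
\<close>
lemma nn_integral_count_space_fibres:
  fixes F :: "'a \<Rightarrow> ennreal"
  shows "(\<integral>\<^sup>+z. (\<integral>\<^sup>+y. F y \<partial>count_space {y\<in>S. \<phi> y = z}) \<partial>count_space Z)
       = (\<integral>\<^sup>+y. F y \<partial>count_space {y\<in>S. \<phi> y \<in> Z})"
proof -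
  have "(\<integral>\<^sup>+z. (\<integral>\<^sup>+y. F y \<partial>count_space {y\<in>S. \<phi> y = z}) \<partial>count_space Z)
     = (\<integral>\<^sup>+z. (\<integral>\<^sup>+y. F y * indicator S y * indicator Z z * indicator {\<phi> y} z \<partial>count_space UNIV)
          \<partial>count_space UNIV)"
    (is "_ = ?R")
  proof -
    have inner: "(\<integral>\<^sup>+y. F y \<partial>count_space {y\<in>S. \<phi> y = z}) * indicator Z z
        = (\<integral>\<^sup>+y. F y * indicator S y * indicator Z z * indicator {\<phi> y} z \<partial>count_space UNIV)" for z
    proof -
      have "(\<integral>\<^sup>+y. F y \<partial>count_space {y\<in>S. \<phi> y = z}) * indicator Z z
        = (\<integral>\<^sup>+y. F y * indicator {y\<in>S. \<phi> y = z} y * indicator Z z \<partial>count_space UNIV)"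
        by (simp add: nn_integral_count_space_indicator nn_integral_multc)
      also have "\<dots> = (\<integral>\<^sup>+y. F y * indicator S y * indicator Z z * indicator {\<phi> y} z \<partial>count_space UNIV)"
        by (intro nn_integral_cong) (simp add: indicator_def)
      finally show ?thesis .
    qed
    show ?thesis
      by (subst nn_integral_count_space_indicator) (simp_all add: inner)
  qed
  also have "\<dots> = (\<integral>\<^sup>+y. (\<integral>\<^sup>+z. F y * indicator S y * indicator Z z * indicator {\<phi> y} z
          \<partial>count_space UNIV) \<partial>count_space UNIV)"
    using nn_integral_fst_count_space[of "\<lambda>(z, y). F y * indicator S y * indicator Z z * indicator {\<phi> y} z"]
      nn_integral_snd_count_space[of "\<lambda>(z, y). F y * indicator S y * indicator Z z * indicator {\<phi> y} z"]
    by simp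
  also have "\<dots> = (\<integral>\<^sup>+y. F y * indicator {y\<in>S. \<phi> y \<in> Z} y \<partial>count_space UNIV)"
    by (intro nn_integral_cong, subst nn_integral_indicator_singleton) (auto simp: indicator_def)
  also have "\<dots> = (\<integral>\<^sup>+y. F y \<partial>count_space {y\<in>S. \<phi> y \<in> Z})"
    by (simp add: nn_integral_count_space_indicator)
  finally show ?thesis .
qed

lemma nn_integral_count_space_subset:
  fixes f :: "'a \<Rightarrow> ennreal"
  assumes "A \<subseteq> B"
  shows "(\<integral>\<^sup>+y. f y * indicator A y \<partial>count_space B) = (\<integral>\<^sup>+y. f y \<partial>count_space A)"
proof -
  have "(\<integral>\<^sup>+y. f y * indicator A y \<partial>count_space B) = (\<integral>\<^sup>+y. f y * indicator A y \<partial>count_space A)"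
    using assms by (intro nn_integral_count_space_eq) auto
  also have "\<dots> = (\<integral>\<^sup>+y. f y \<partial>count_space A)"
    by (intro nn_integral_cong) simp
  finally show ?thesis .
qed

lemma nn_integral_count_space_mono_set:
  fixes f :: "'a \<Rightarrow> ennreal"
  assumes "A \<subseteq> B"
  shows "(\<integral>\<^sup>+y. f y \<partial>count_space A) \<le> (\<integral>\<^sup>+y. f y \<partial>count_space B)"
  unfolding nn_integral_count_space_subset[OF assms, symmetric]
  by (intro nn_integral_mono) (auto simp: indicator_def)

section \<open>A maximal inequality for positive contractions\<close>

text \<open>
  Garsia's argument, carried out with functions that take values in \<open>[0, \<infinity>]\<close>. Let \<open>m\<close> be the maximum
  over \<open>n \<le> N\<close> of the truncated differences \<open>S n - n \<phi>\<close>. Where \<open>m > 0\<close>, the recursion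
  \<open>S (n + 1) = f + P (S n)\<close> together with \<open>S n \<le> m + n \<phi>\<close> and \<open>P \<phi> \<le> \<phi>\<close> gives \<open>m + \<phi> \<le> f + P m\<close>;
  integrating, \<open>\<integral> P m \<le> \<integral> m\<close> cancels \<open>m\<close>. A function \<open>\<phi>\<close> in place of a constant threshold makes the
  inequality applicable to thresholds that are only invariant.
\<close>
lemma hopf_maximal_inequality:
  fixes P :: "('a \<Rightarrow> ennreal) \<Rightarrow> 'a \<Rightarrow> ennreal" and \<phi> f :: "'a \<Rightarrow> ennreal"
  assumes P_meas: "\<And>f. f \<in> borel_measurable M \<Longrightarrow> P f \<in> borel_measurable M"
    and P_mono: "\<And>f g. f \<le> g \<Longrightarrow> P f \<le> P g"
    and P_add: "\<And>f g. P (\<lambda>x. f x + g x) = (\<lambda>x. P f x + P g x)"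
    and P_mult: "\<And>n f. P (\<lambda>x. of_nat n * f x) = (\<lambda>x. of_nat n * P f x)"
    and P_int: "\<And>f. f \<in> borel_measurable M \<Longrightarrow> (\<integral>\<^sup>+x. P f x \<partial>M) \<le> (\<integral>\<^sup>+x. f x \<partial>M)"
    and \<phi> [measurable]: "\<phi> \<in> borel_measurable M" and \<phi>_fin: "\<And>x. \<phi> x < \<infinity>"
    and \<phi>_sub: "AE x in M. P \<phi> x \<le> \<phi> x"
    and f [measurable]: "f \<in> borel_measurable M" and f_int: "(\<integral>\<^sup>+x. f x \<partial>M) < \<infinity>"
  defines "A \<equiv> {x\<in>space M. \<exists>n. of_nat n * \<phi> x < (\<Sum>k<n. (P ^^ k) f x)}"
  shows "(\<integral>\<^sup>+x\<in>A. \<phi> x \<partial>M) \<le> (\<integral>\<^sup>+x\<in>A. f x \<partial>M)"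
proof -
  define S where "S n x = (\<Sum>k<n. (P ^^ k) f x)" for n x
  define m where "m N x = (MAX n\<in>{..N}. S n x - of_nat n * \<phi> x)" for N x
  define B where "B N = {x\<in>space M. \<exists>n\<le>N. of_nat n * \<phi> x < S n x}" for N
  have [measurable]: "(P ^^ k) f \<in> borel_measurable M" for k
    by (induction k) (auto intro: P_meas)
  have [measurable]: "S n \<in> borel_measurable M" for n unfolding S_def by measurable
  have [measurable]: "m N \<in> borel_measurable M" for N unfolding m_def by measurable
  have [measurable]: "B N \<in> sets M" for N unfolding B_def by measurable
  have P_zero: "P (\<lambda>x. 0) = (\<lambda>x. 0)" using P_mult[of 0 "\<lambda>x. 0"] by simp
  have S_Suc: "S (Suc n) x = f x + P (S n) x" for n x
  proof (induction n arbitrary: x)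
    case 0
    have "S 0 = (\<lambda>x. 0)" by (simp add: S_def fun_eq_iff)
    then show ?case by (simp add: S_def P_zero)
  next
    case (Suc n)
    have "S (Suc n) = (\<lambda>x. S n x + (P ^^ n) f x)" by (simp add: S_def fun_eq_iff)
    then have "P (S (Suc n)) x = P (\<lambda>x. S n x + (P ^^ n) f x) x" by simp
    also have "\<dots> = P (S n) x + (P ^^ Suc n) f x"
      by (simp add: P_add)
    finally have "f x + P (S (Suc n)) x = S (Suc n) x + (P ^^ Suc n) f x"
      by (simp only: Suc add.assoc)
    also have "\<dots> = S (Suc (Suc n)) x" unfolding S_def by (rule sum.lessThan_Suc[symmetric])
    finally show ?case by (rule sym)
  qed
  have S_int: "(\<integral>\<^sup>+x. S n x \<partial>M) < \<infinity>" for n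
  proof -
    have int_pow: "(\<integral>\<^sup>+x. (P ^^ k) f x \<partial>M) \<le> (\<integral>\<^sup>+x. f x \<partial>M)" for k
    proof (induction k)
      case (Suc k)
      then show ?case using P_int[of "(P ^^ k) f"] by (auto intro: order_trans)
    qed simp
    have "(\<integral>\<^sup>+x. S n x \<partial>M) = (\<Sum>k<n. \<integral>\<^sup>+x. (P ^^ k) f x \<partial>M)"
      unfolding S_def by (rule nn_integral_sum) measurable
    also have "\<dots> < \<infinity>"
      using int_pow f_int by (auto simp: ennreal_sum_less_top intro: le_less_trans)
    finally show ?thesis .
  qed
  have fin: "(\<integral>\<^sup>+x\<in>B N. \<phi> x \<partial>M) \<le> (\<integral>\<^sup>+x\<in>B N. f x \<partial>M)" for N
  proof -
    have S_le: "S n x \<le> m N x + of_nat n * \<phi> x" if "n \<le> N" for n x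
    proof -
      have "S n x - of_nat n * \<phi> x \<le> m N x" unfolding m_def using that by (intro Max_ge) auto
      then show ?thesis by (simp add: ennreal_minus_le_iff add.commute)
    qed
    have m_off: "m N x = 0" if "x \<in> space M" "x \<notin> B N" for x
    proof -
      have "S n x - of_nat n * \<phi> x = 0" if "n \<le> N" for n
      proof -
        have le: "S n x \<le> of_nat n * \<phi> x" using \<open>x \<notin> B N\<close> \<open>x \<in> space M\<close> that
          by (auto simp: B_def not_less)
        moreover have "of_nat n * \<phi> x < top"
          using \<phi>_fin[of x] by (simp add: ennreal_mult_less_top of_nat_less_top)
        ultimately show ?thesis by (simp add: diff_eq_0_iff_ennreal)
      qed
      then have "(\<lambda>n. S n x - of_nat n * \<phi> x) ` {..N} = {0}" by force
      then show ?thesis by (simp add: m_def)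
    qed
    have on: "m N x + \<phi> x \<le> f x + P (m N) x" if x: "x \<in> B N" and sub: "P \<phi> x \<le> \<phi> x" for x
    proof -
      have "m N x \<in> (\<lambda>n. S n x - of_nat n * \<phi> x) ` {..N}" unfolding m_def by (intro Max_in) auto
      then obtain n where n: "n \<le> N" "m N x = S n x - of_nat n * \<phi> x" by auto
      obtain n' where n': "n' \<le> N" "of_nat n' * \<phi> x < S n' x" using x by (auto simp: B_def)
      then have "0 < S n' x - of_nat n' * \<phi> x" by (simp add: diff_gr0_ennreal)
      also have "\<dots> \<le> m N x" unfolding m_def using n' by (intro Max_ge) auto
      finally have pos: "0 < S n x - of_nat n * \<phi> x" by (simp add: n)
      have less: "of_nat n * \<phi> x < S n x"
      proof (rule ccontr)
        assume "\<not> of_nat n * \<phi> x < S n x"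
        then have le: "S n x \<le> of_nat n * \<phi> x" by simp
        moreover have "of_nat n * \<phi> x < top"
          using \<phi>_fin[of x] by (simp add: ennreal_mult_less_top of_nat_less_top)
        ultimately have "S n x - of_nat n * \<phi> x = 0" by (simp add: diff_eq_0_iff_ennreal)
        with pos show False by simp
      qed
      then obtain j where j: "n = Suc j" by (cases n) (auto simp: S_def)
      have fin: "of_nat j * \<phi> x < \<infinity>" using \<phi>_fin[of x] by (simp add: ennreal_mult_less_top of_nat_less_top)
      have "of_nat j * \<phi> x + (m N x + \<phi> x) = m N x + of_nat n * \<phi> x"
      proof -
        have "of_nat n * \<phi> x = \<phi> x + of_nat j * \<phi> x" by (simp add: j distrib_right)
        then show ?thesis by (simp only: ac_simps)
      qed
      also have "\<dots> = S n x"
        unfolding n(2) using less by (intro diff_add_cancel_ennreal) simp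
      also have "\<dots> = f x + P (S j) x" by (simp add: j S_Suc)
      also have "\<dots> \<le> f x + P (\<lambda>x. m N x + of_nat j * \<phi> x) x"
        using P_mono[of "S j" "\<lambda>x. m N x + of_nat j * \<phi> x"] S_le[of j] n(1) j
        by (intro add_left_mono) (auto simp: le_fun_def)
      also have "\<dots> = f x + (P (m N) x + of_nat j * P \<phi> x)" by (simp add: P_add P_mult)
      also have "\<dots> \<le> f x + (P (m N) x + of_nat j * \<phi> x)"
        by (intro add_left_mono mult_left_mono sub) simp
      also have "\<dots> = of_nat j * \<phi> x + (f x + P (m N) x)" by (simp add: ac_simps)
      finally show ?thesis using fin unfolding ennreal_add_left_cancel_le by auto
    qed
    have m_int: "(\<integral>\<^sup>+x. m N x \<partial>M) < \<infinity>"
    proof -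
      have le: "S n x - of_nat n * \<phi> x \<le> S N x" if "n \<le> N" for n x
      proof -
        have "S n x - of_nat n * \<phi> x \<le> S n x" by (rule diff_le_self_ennreal)
        also have "\<dots> \<le> S N x" unfolding S_def using that by (intro sum_mono2) auto
        finally show ?thesis .
      qed
      have "m N x \<le> S N x" for x
        unfolding m_def by (rule Max.boundedI) (auto intro: le)
      then have "(\<integral>\<^sup>+x. m N x \<partial>M) \<le> (\<integral>\<^sup>+x. S N x \<partial>M)" by (intro nn_integral_mono)
      then show ?thesis using S_int by (rule le_less_trans)
    qed
    have "(\<integral>\<^sup>+x. m N x \<partial>M) + (\<integral>\<^sup>+x\<in>B N. \<phi> x \<partial>M)
        = (\<integral>\<^sup>+x. m N x + \<phi> x * indicator (B N) x \<partial>M)"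
      by (rule nn_integral_add[symmetric]) measurable
    also have "\<dots> = (\<integral>\<^sup>+x. (m N x + \<phi> x) * indicator (B N) x \<partial>M)"
      using m_off by (intro nn_integral_cong) (auto simp: indicator_def)
    also have "\<dots> \<le> (\<integral>\<^sup>+x. f x * indicator (B N) x + P (m N) x \<partial>M)"
      using \<phi>_sub by (intro nn_integral_mono_AE, eventually_elim) (auto simp: indicator_def on)
    also have "\<dots> = (\<integral>\<^sup>+x\<in>B N. f x \<partial>M) + (\<integral>\<^sup>+x. P (m N) x \<partial>M)"
      by (intro nn_integral_add P_meas) measurable
    also have "\<dots> \<le> (\<integral>\<^sup>+x\<in>B N. f x \<partial>M) + (\<integral>\<^sup>+x. m N x \<partial>M)"
      by (intro add_left_mono P_int) measurable
    also have "\<dots> = (\<integral>\<^sup>+x. m N x \<partial>M) + (\<integral>\<^sup>+x\<in>B N. f x \<partial>M)" by (rule add.commute)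
    finally show ?thesis using m_int unfolding ennreal_add_left_cancel_le by auto
  qed
  have A: "A = (\<Union>N. B N)" by (auto simp: A_def B_def S_def)
  have [measurable]: "A \<in> sets M" unfolding A by measurable
  have "incseq B" unfolding B_def incseq_def by (auto intro: order_trans)
  then have "(SUP N. emeasure (density M \<phi>) (B N)) = emeasure (density M \<phi>) A"
    unfolding A by (intro SUP_emeasure_incseq) auto
  then have "(\<integral>\<^sup>+x\<in>A. \<phi> x \<partial>M) = (SUP N. \<integral>\<^sup>+x\<in>B N. \<phi> x \<partial>M)"
    by (simp add: emeasure_density)
  also have "\<dots> \<le> (\<integral>\<^sup>+x\<in>A. f x \<partial>M)"
  proof (rule SUP_least)
    fix N
    have "(\<integral>\<^sup>+x\<in>B N. f x \<partial>M) \<le> (\<integral>\<^sup>+x\<in>A. f x \<partial>M)"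
      by (intro nn_integral_mono) (auto simp: A indicator_def)
    with fin[of N] show "(\<integral>\<^sup>+x\<in>B N. \<phi> x \<partial>M) \<le> (\<integral>\<^sup>+x\<in>A. f x \<partial>M)" by (rule order_trans)
  qed
  finally show ?thesis .
qed

section \<open>Truncation and powers\<close>

definition truncate :: "nat \<Rightarrow> real \<Rightarrow> real" where
  "truncate n t = max (- real n) (min t (real n))"

lemma abs_truncate_le: "\<bar>truncate n t\<bar> \<le> real n"
  by (auto simp: truncate_def)

lemma abs_diff_truncate_le: "\<bar>t - truncate n t\<bar> \<le> \<bar>t\<bar>"
  by (auto simp: truncate_def)

lemma truncate_tendsto_Lp:
  assumes "0 < p" and [measurable]: "f \<in> borel_measurable M" and int: "integrable M (\<lambda>x. \<bar>f x\<bar> powr p)"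
  shows "(\<lambda>n. \<integral>x. \<bar>f x - truncate n (f x)\<bar> powr p \<partial>M) \<longlonglongrightarrow> 0"
proof -
  have [measurable]: "(\<lambda>x. truncate n (f x)) \<in> borel_measurable M" for n
    unfolding truncate_def by measurable
  have "(\<lambda>n. \<integral>x. \<bar>f x - truncate n (f x)\<bar> powr p \<partial>M) \<longlonglongrightarrow> (\<integral>x. 0 \<partial>M)"
  proof (rule integral_dominated_convergence[where w = "\<lambda>x. \<bar>f x\<bar> powr p"])
    show "AE x in M. (\<lambda>n. \<bar>f x - truncate n (f x)\<bar> powr p) \<longlonglongrightarrow> 0"
    proof (rule AE_I2)
      fix x
      have "\<forall>\<^sub>F n in sequentially. \<bar>f x - truncate n (f x)\<bar> powr p = 0"
        using eventually_ge_at_top[of "nat \<lceil>\<bar>f x\<bar>\<rceil>"]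
      proof eventually_elim
        case (elim n)
        then have "\<bar>f x\<bar> \<le> real n" by linarith
        then show ?case by (auto simp: truncate_def)
      qed
      then show "(\<lambda>n. \<bar>f x - truncate n (f x)\<bar> powr p) \<longlonglongrightarrow> 0" by (rule tendsto_eventually)
    qed
    show "AE x in M. norm (\<bar>f x - truncate n (f x)\<bar> powr p) \<le> \<bar>f x\<bar> powr p" for n
      using \<open>0 < p\<close> by (auto intro!: powr_mono2 abs_diff_truncate_le)
  qed (use int in auto)
  then show ?thesis by simp
qed

lemma powr_above_tangent:
  fixes p a t :: real
  assumes p: "1 \<le> p" and a: "0 \<le> a" and t: "0 \<le> t"
  shows "a powr p + p * a powr (p - 1) * (t - a) \<le> t powr p"
proof (cases "a = 0 \<or> t = 0")
  case True
  show ?thesis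
  proof (cases "a = 0")
    case False
    then have "a > 0" "t = 0" using a True by auto
    then have "a powr (p - 1) * a = a powr p" by (simp add: powr_mult_base mult.commute)
    then have "a powr p + p * a powr (p - 1) * (t - a) = (1 - p) * a powr p"
      using \<open>t = 0\<close> by (simp add: algebra_simps)
    also have "\<dots> \<le> t powr p" using p \<open>t = 0\<close> by (simp add: mult_nonpos_nonneg)
    finally show ?thesis .
  qed simp
next
  case False
  then have "a > 0" "t > 0" using a t by auto
  have "p * a powr (p - 1) * (t - a) \<le> t powr p - a powr p"
  proof (rule convex_on_imp_above_tangent[where A = "{0<..}"])
    show "convex_on {0<..} (\<lambda>x. x powr p)" by (rule powr_convex[OF p])
    show "((\<lambda>x. x powr p) has_real_derivative p * a powr (p - 1)) (at a within {0<..})"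
      by (rule has_field_derivative_at_within[OF has_real_derivative_powr[OF \<open>a > 0\<close>]])
  qed (use \<open>a > 0\<close> \<open>t > 0\<close> in \<open>auto simp: interior_open\<close>)
  then show ?thesis by simp
qed

text \<open>
  A crude substitute for Minkowski's inequality: the constant is irrelevant for convergence to
  zero.
\<close>
lemma abs_add3_powr_le:
  fixes a b d :: real
  assumes "0 \<le> p"
  shows "\<bar>a + b + d\<bar> powr p \<le> 3 powr p * (\<bar>a\<bar> powr p + \<bar>b\<bar> powr p + \<bar>d\<bar> powr p)"
proof -
  define m where "m = max \<bar>a\<bar> (max \<bar>b\<bar> \<bar>d\<bar>)"
  have "\<bar>a + b + d\<bar> \<le> 3 * m" unfolding m_def by linarith
  then have "\<bar>a + b + d\<bar> powr p \<le> (3 * m) powr p"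
    using assms by (intro powr_mono2) auto
  also have "\<dots> = 3 powr p * m powr p" by (simp add: powr_mult m_def)
  also have "m powr p \<le> \<bar>a\<bar> powr p + \<bar>b\<bar> powr p + \<bar>d\<bar> powr p"
    by (auto simp: m_def max_def)
  finally show ?thesis by simp
qed

lemma Lp_integrable:
  assumes "finite_measure M" "f \<in> Lp M p" "1 \<le> p"
  shows "integrable M f"
proof (rule Bochner_Integration.integrable_bound)
  interpret finite_measure M by fact
  show "integrable M (\<lambda>x. 1 + \<bar>f x\<bar> powr p)" using assms(2) by (simp add: Lp_def)
  show "f \<in> borel_measurable M" using assms(2) by (simp add: Lp_def)
  have "t \<le> 1 + t powr p" if "0 \<le> t" for t :: real
  proof (cases "t \<le> 1")
    case True
    then show ?thesis by (simp add: add_increasing2)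
  next
    case False
    then have "t powr 1 \<le> t powr p" using assms(3) by (intro powr_mono) auto
    with False show ?thesis by simp
  qed
  then show "AE x in M. norm (f x) \<le> norm (1 + \<bar>f x\<bar> powr p)"
    by (simp add: abs_of_nonneg)
qed

section \<open>Measure-preserving maps: Birkhoff averages and coboundaries\<close>

locale measure_preserving_system = prob_space M
  for M :: "'a measure" and T :: "'a \<Rightarrow> 'a" +
  assumes pres: "measure_preserving_map M T"
begin

lemma T_measurable [measurable]: "T \<in> measurable M M"
  using pres by (simp add: measure_preserving_map_def)

lemma T_pow_measurable [measurable]: "(T ^^ n) \<in> measurable M M"
  by (induction n) (auto intro: measurable_comp[OF _ T_measurable])

lemma T_space [simp]: "x \<in> space M \<Longrightarrow> T x \<in> space M"
  using measurable_space[OF T_measurable] .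

lemma T_pow_space [simp]: "x \<in> space M \<Longrightarrow> (T ^^ n) x \<in> space M"
  using measurable_space[OF T_pow_measurable] .

lemma nn_integral_T:
  assumes "f \<in> borel_measurable M"
  shows "(\<integral>\<^sup>+x. f (T x) \<partial>M) = (\<integral>\<^sup>+x. f x \<partial>M)"
  using nn_integral_distr[OF T_measurable, of f] assms pres
  by (simp add: measure_preserving_map_def)

abbreviation "Inv \<equiv> invariant_algebra M T"

lemma space_Inv: "space Inv = space M"
  unfolding invariant_algebra_def by (rule space_measure_of) (auto dest: sets.sets_into_space)

lemma sets_Inv: "sets Inv = {A \<in> sets M. T -` A \<inter> space M = A}"
proof -
  have "sigma_algebra (space M) {A \<in> sets M. T -` A \<inter> space M = A}"
    unfolding sigma_algebra_iff2
  proof (intro conjI ballI allI impI)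
    fix A assume A: "A \<in> {A \<in> sets M. T -` A \<inter> space M = A}"
    then have "T -` A \<inter> space M = A" by simp
    then have "T -` (space M - A) \<inter> space M = space M - A" by auto
    with A show "space M - A \<in> {A \<in> sets M. T -` A \<inter> space M = A}" by auto
  next
    fix A :: "nat \<Rightarrow> 'a set" assume A: "range A \<subseteq> {A \<in> sets M. T -` A \<inter> space M = A}"
    then have "T -` A i \<inter> space M = A i" for i by auto
    note inv = this
    have "T -` (\<Union>i. A i) \<inter> space M = (\<Union>i. T -` A i \<inter> space M)" by blast
    also have "\<dots> = (\<Union>i. A i)" by (simp only: inv)
    finally have "T -` (\<Union>i. A i) \<inter> space M = (\<Union>i. A i)" .
    with A show "(\<Union>i. A i) \<in> {A \<in> sets M. T -` A \<inter> space M = A}" by auto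
  qed (auto dest: sets.sets_into_space)
  then show ?thesis
    unfolding invariant_algebra_def
    by (subst sets_measure_of) (auto dest: sets.sets_into_space sigma_algebra.sigma_sets_eq)
qed

lemma subalgebra_Inv: "subalgebra M Inv"
  by (auto simp: subalgebra_def space_Inv sets_Inv)

sublocale inv: finite_measure_subalgebra M Inv
  by unfold_locales (rule subalgebra_Inv)

lemma Inv_measurable_invariant:
  fixes g :: "'a \<Rightarrow> real"
  assumes "g \<in> borel_measurable Inv" "x \<in> space M"
  shows "g (T x) = g x"
proof -
  have "g -` {g x} \<inter> space Inv \<in> sets Inv"
    using assms(1) by (intro measurable_sets) auto
  then have "T -` (g -` {g x} \<inter> space M) \<inter> space M = g -` {g x} \<inter> space M"
    by (simp add: sets_Inv space_Inv)
  moreover have "x \<in> g -` {g x} \<inter> space M" using assms(2) by simp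
  ultimately have "x \<in> T -` (g -` {g x} \<inter> space M) \<inter> space M" by simp
  then show ?thesis by simp
qed

definition birkhoff_average :: "nat \<Rightarrow> ('a \<Rightarrow> real) \<Rightarrow> 'a \<Rightarrow> real" where
  "birkhoff_average n u x = (\<Sum>k<n. u ((T ^^ k) x)) / n"

lemma birkhoff_average_measurable [measurable]:
  assumes "u \<in> borel_measurable M"
  shows "birkhoff_average n u \<in> borel_measurable M"
proof -
  have [measurable]: "(\<lambda>x. u ((T ^^ k) x)) \<in> borel_measurable M" for k
    by (rule measurable_compose[OF T_pow_measurable assms])
  show ?thesis unfolding birkhoff_average_def by measurable
qed

lemma birkhoff_T: "birkhoff_average n u (T x) = (u ((T ^^ n) x) - u x) / n + birkhoff_average n u x"
proof -
  have "(\<Sum>k<n. u ((T ^^ k) (T x))) = (\<Sum>k<n. u ((T ^^ Suc k) x))"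
    by (simp add: funpow_swap1)
  also have "\<dots> = u ((T ^^ n) x) - u x + (\<Sum>k<n. u ((T ^^ k) x))"
    using sum.lessThan_Suc_shift[of "\<lambda>k. u ((T ^^ k) x)" n] by simp
  finally show ?thesis by (simp add: birkhoff_average_def add_divide_distrib)
qed

text \<open>Replacing \<open>x\<close> by \<open>T x\<close> changes an average of a bounded function by \<open>O(1 / n)\<close>.\<close>
lemma limsup_birkhoff_T:
  assumes "\<And>x. \<bar>u x\<bar> \<le> C"
  shows "limsup (\<lambda>n. ereal (birkhoff_average n u (T x))) = limsup (\<lambda>n. ereal (birkhoff_average n u x))"
proof -
  define d where "d n = (u ((T ^^ n) x) - u x) / real n" for n
  have "d \<longlonglongrightarrow> 0"
  proof (rule Lim_null_comparison)
    have "\<bar>u ((T ^^ n) x) - u x\<bar> \<le> 2 * C" for n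
      using assms[of x] assms[of "(T ^^ n) x"] by linarith
    then show "\<forall>\<^sub>F n in sequentially. norm (d n) \<le> (2 * C) / real n"
      unfolding d_def by (intro always_eventually) (simp add: divide_right_mono)
    show "(\<lambda>n. (2 * C) / real n) \<longlonglongrightarrow> 0" by (rule lim_const_over_n)
  qed
  then have "(\<lambda>n. ereal (d n)) \<longlonglongrightarrow> 0" by (simp add: zero_ereal_def)
  from ereal_limsup_lim_add[OF this, of "\<lambda>n. ereal (birkhoff_average n u x)"]
  show ?thesis by (simp add: birkhoff_T d_def)
qed

text \<open>
  The set \<open>E\<close> on which the upper limit exceeds the conditional expectation by more than \<open>e\<close> is
  invariant. So the maximal inequality for the Koopman operator, restricted to \<open>E\<close>, bounds the
  integral over \<open>E\<close> of the conditional expectation plus \<open>e\<close> by that of \<open>u\<close>. The integrals of \<open>u\<close> and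
  of its conditional expectation over \<open>E\<close> agree, so \<open>E\<close> is null.
\<close>
lemma limsup_birkhoff_le:
  assumes [measurable]: "u \<in> borel_measurable M" and u: "\<And>x. 0 \<le> u x" "\<And>x. u x \<le> C" and "e > 0"
  shows "AE x in M. limsup (\<lambda>n. ereal (birkhoff_average n u x)) \<le> ereal (real_cond_exp M Inv u x + e)"
proof -
  have u_int: "integrable M u" by (rule integrable_const_bound[where B = C]) (use u in auto)
  \<comment> \<open>The positive part changes nothing almost everywhere and makes \<open>b + e\<close> a nonnegative threshold.\<close>
  define b where "b x = max 0 (real_cond_exp M Inv u x)" for x
  have b_Inv: "b \<in> borel_measurable Inv" unfolding b_def by measurable
  then have [measurable]: "b \<in> borel_measurable M" by (rule measurable_from_subalg[OF subalgebra_Inv])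
  have b: "AE x in M. b x = real_cond_exp M Inv u x"
  proof -
    have "AE x in M. 0 \<le> real_cond_exp M Inv u x" by (rule inv.real_cond_exp_pos) (use u in auto)
    then show ?thesis by eventually_elim (simp add: b_def)
  qed
  have b_int: "integrable M b"
    using integrable_cong_AE[OF _ _ b] inv.real_cond_exp_int(1)[OF u_int] by simp
  have b_T: "b (T x) = b x" if "x \<in> space M" for x
    using Inv_measurable_invariant[OF b_Inv that] .
  define E where "E = {x\<in>space M. limsup (\<lambda>n. ereal (birkhoff_average n u x)) > ereal (b x + e)}"
  have [measurable]: "E \<in> sets M" unfolding E_def by measurable
  have E_T: "T x \<in> E \<longleftrightarrow> x \<in> E" if "x \<in> space M" for x
    using that u limsup_birkhoff_T[of u C x] by (simp add: E_def b_T)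
  then have "T -` E \<inter> space M = E" by (auto simp: E_def)
  then have E_Inv: "E \<in> sets Inv" by (simp add: sets_Inv)
  have E_pow: "(T ^^ k) x \<in> E \<longleftrightarrow> x \<in> E" if "x \<in> space M" for k x
    using that by (induction k) (simp_all add: E_T)

  \<comment> \<open>the Koopman operator\<close>
  define K where "K f = (\<lambda>x. f (T x))" for f :: "'a \<Rightarrow> ennreal"
  define f where "f x = ennreal (u x) * indicator E x" for x
  define \<phi> where "\<phi> x = ennreal (b x + e) * indicator E x" for x
  have [measurable]: "f \<in> borel_measurable M" "\<phi> \<in> borel_measurable M"
    unfolding f_def[abs_def] \<phi>_def[abs_def] by measurable
  have K_pow: "(K ^^ k) f x = f ((T ^^ k) x)" for k x
    by (induction k arbitrary: x) (simp_all add: K_def funpow_swap1[of T])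
  have b_pos: "b x \<ge> 0" for x by (simp add: b_def)
  let ?A = "{x\<in>space M. \<exists>n. of_nat n * \<phi> x < (\<Sum>k<n. (K ^^ k) f x)}"
  have A: "?A = E"
  proof (intro equalityI subsetI)
    fix x assume x: "x \<in> ?A"
    show "x \<in> E"
    proof (rule ccontr)
      assume "x \<notin> E"
      then show False using x by (auto simp: K_pow f_def E_pow)
    qed
  next
    fix x assume x: "x \<in> E"
    then have xM: "x \<in> space M" by (simp add: E_def)
    have "\<not> (\<forall>\<^sub>F n in sequentially. ereal (birkhoff_average n u x) \<le> ereal (b x + e))"
    proof
      assume "\<forall>\<^sub>F n in sequentially. ereal (birkhoff_average n u x) \<le> ereal (b x + e)"
      from Limsup_bounded[OF this] x show False by (auto simp: E_def dest: leD)
    qed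
    then obtain n where n: "n \<ge> 1" "birkhoff_average n u x > b x + e"
      unfolding eventually_sequentially by (force simp: not_le)
    then have "real n * (b x + e) < (\<Sum>k<n. u ((T ^^ k) x))"
      by (simp add: birkhoff_average_def field_simps)
    then have "ennreal (real n * (b x + e)) < ennreal (\<Sum>k<n. u ((T ^^ k) x))"
      using b_pos[of x] \<open>e > 0\<close> by (intro ennreal_lessI) (auto intro: le_less_trans[rotated])
    also have "ennreal (real n * (b x + e)) = of_nat n * \<phi> x"
      using x b_pos[of x] \<open>e > 0\<close> by (simp add: \<phi>_def ennreal_mult ennreal_of_nat_eq_real_of_nat)
    also have "ennreal (\<Sum>k<n. u ((T ^^ k) x)) = (\<Sum>k<n. (K ^^ k) f x)"
      using x u by (simp add: K_pow f_def E_pow[OF xM] sum_ennreal)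
    finally show "x \<in> ?A" using xM by auto
  qed
  have max_ineq: "(\<integral>\<^sup>+x\<in>?A. \<phi> x \<partial>M) \<le> (\<integral>\<^sup>+x\<in>?A. f x \<partial>M)"
  proof (rule hopf_maximal_inequality)
    show "K g \<in> borel_measurable M" if "g \<in> borel_measurable M" for g
      using that unfolding K_def by measurable
    show "(\<integral>\<^sup>+x. K g x \<partial>M) \<le> (\<integral>\<^sup>+x. g x \<partial>M)" if "g \<in> borel_measurable M" for g
      using nn_integral_T[OF that] by (simp add: K_def)
    show "AE x in M. K \<phi> x \<le> \<phi> x"
      by (rule AE_I2) (simp add: K_def \<phi>_def E_T b_T indicator_def)
    show "\<phi> x < \<infinity>" for x by (simp add: \<phi>_def indicator_def)
    have "(\<integral>\<^sup>+x. f x \<partial>M) \<le> (\<integral>\<^sup>+x. ennreal C \<partial>M)"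
      using u by (intro nn_integral_mono) (auto simp: f_def indicator_def intro: ennreal_leI)
    also have "\<dots> < \<infinity>" by (simp add: emeasure_space_1)
    finally show "(\<integral>\<^sup>+x. f x \<partial>M) < \<infinity>" .
  qed (auto simp: K_def le_fun_def f_def \<phi>_def)
  then have "(\<integral>\<^sup>+x. ennreal (indicator E x * (b x + e)) \<partial>M) \<le> (\<integral>\<^sup>+x. ennreal (indicator E x * u x) \<partial>M)"
  proof -
    have "\<phi> x * indicator E x = ennreal (indicator E x * (b x + e))"
      "f x * indicator E x = ennreal (indicator E x * u x)" for x
      by (cases "x \<in> E"; simp add: f_def \<phi>_def)+
    then show ?thesis using max_ineq unfolding A by simp
  qed
  moreover have be_int: "integrable M (\<lambda>x. indicator E x * (b x + e))"
    using integrable_mult_indicator[of E M "\<lambda>x. b x + e"] b_int by simp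
  moreover have ue_int: "integrable M (\<lambda>x. indicator E x * u x)"
    using integrable_mult_indicator[of E M u] u_int by simp
  ultimately have "(\<integral>x. indicator E x * (b x + e) \<partial>M) \<le> (\<integral>x. indicator E x * u x \<partial>M)"
    using u b_pos \<open>e > 0\<close>
    by (simp add: nn_integral_eq_integral ennreal_le_iff integral_nonneg_AE add_nonneg_nonneg)
  also have "\<dots> = (\<integral>x. indicator E x * real_cond_exp M Inv u x \<partial>M)"
    using inv.real_cond_exp_intA[OF u_int E_Inv] by (simp add: set_lebesgue_integral_def)
  also have "\<dots> = (\<integral>x. indicator E x * b x \<partial>M)"
    using b by (intro integral_cong_AE) auto
  finally have "(\<integral>x. indicator E x * (b x + e) \<partial>M) - (\<integral>x. indicator E x * b x \<partial>M) \<le> 0" by simp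
  moreover have "(\<integral>x. indicator E x * (b x + e) \<partial>M) - (\<integral>x. indicator E x * b x \<partial>M)
      = (\<integral>x. indicator E x * e \<partial>M)"
  proof -
    have "integrable M (\<lambda>x. indicator E x * b x)"
      using integrable_mult_indicator[of E M b] b_int by simp
    from Bochner_Integration.integral_diff[OF be_int this] show ?thesis
      by (simp add: algebra_simps)
  qed
  ultimately have "measure M E * e \<le> 0" by simp
  then have "measure M E = 0" using \<open>e > 0\<close> by (simp add: mult_le_0_iff measure_le_0_iff)
  then have "AE x in M. x \<notin> E" by (intro AE_not_in) (auto simp: null_sets_def emeasure_eq_measure)
  then show ?thesis using b AE_space by eventually_elim (auto simp: E_def not_less)
qed

lemma birkhoff_upper:
  assumes [measurable]: "u \<in> borel_measurable M" and u: "\<And>x. 0 \<le> u x" "\<And>x. u x \<le> C"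
  shows "AE x in M. \<forall>e>0. \<forall>\<^sub>F n in sequentially. birkhoff_average n u x < real_cond_exp M Inv u x + e"
proof -
  have "AE x in M. \<forall>j. limsup (\<lambda>n. ereal (birkhoff_average n u x)) \<le> ereal (real_cond_exp M Inv u x + inverse (real (Suc j)))"
    unfolding AE_all_countable by (intro allI limsup_birkhoff_le[of u C] u) auto
  then show ?thesis
  proof eventually_elim
    case (elim x)
    show ?case
    proof (intro allI impI)
      fix e :: real assume "e > 0"
      then obtain j where j: "inverse (real (Suc j)) < e" using reals_Archimedean by blast
      have "limsup (\<lambda>n. ereal (birkhoff_average n u x)) < ereal (real_cond_exp M Inv u x + e)"
        using elim[rule_format, of j] by (rule le_less_trans) (use j in simp)
      from Limsup_lessD[OF this]
      show "\<forall>\<^sub>F n in sequentially. birkhoff_average n u x < real_cond_exp M Inv u x + e" by simp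
    qed
  qed
qed

text \<open>The upper bound for \<open>u + C\<close> and for \<open>C - u\<close> bounds the averages of \<open>u\<close> from both sides.\<close>
lemma birkhoff_theorem_bounded:
  assumes [measurable]: "u \<in> borel_measurable M" and u: "\<And>x. \<bar>u x\<bar> \<le> C"
  shows "AE x in M. (\<lambda>n. birkhoff_average n u x) \<longlonglongrightarrow> real_cond_exp M Inv u x"
proof -
  have u_int: "integrable M u" by (rule integrable_const_bound[where B = C]) (use u in auto)
  have uC: "- C \<le> u x" "u x \<le> C" for x using u[of x] by auto
  let ?b = "real_cond_exp M Inv u"
  have const: "AE x in M. real_cond_exp M Inv (\<lambda>x. C) x = C"
    by (rule inv.real_cond_exp_F_meas) auto
  have up: "AE x in M. \<forall>e>0. \<forall>\<^sub>F n in sequentially. birkhoff_average n (\<lambda>x. u x + C) x < real_cond_exp M Inv (\<lambda>x. u x + C) x + e"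
  proof (rule birkhoff_upper[of _ "2 * C"])
    fix x show "0 \<le> u x + C" "u x + C \<le> 2 * C" using uC[of x] by simp_all
  qed simp
  have lo: "AE x in M. \<forall>e>0. \<forall>\<^sub>F n in sequentially. birkhoff_average n (\<lambda>x. C - u x) x < real_cond_exp M Inv (\<lambda>x. C - u x) x + e"
  proof (rule birkhoff_upper[of _ "2 * C"])
    fix x show "0 \<le> C - u x" "C - u x \<le> 2 * C" using uC[of x] by simp_all
  qed simp
  have add: "AE x in M. real_cond_exp M Inv (\<lambda>x. u x + C) x = ?b x + real_cond_exp M Inv (\<lambda>x. C) x"
    by (rule inv.real_cond_exp_add) (use u_int in auto)
  have diff: "AE x in M. real_cond_exp M Inv (\<lambda>x. C - u x) x = real_cond_exp M Inv (\<lambda>x. C) x - ?b x"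
    by (rule inv.real_cond_exp_diff) (use u_int in auto)
  have shift: "birkhoff_average n (\<lambda>x. u x + C) x = birkhoff_average n u x + C" "birkhoff_average n (\<lambda>x. C - u x) x = C - birkhoff_average n u x"
    if "n \<ge> 1" for n x
    using that by (simp_all add: birkhoff_average_def sum.distrib sum_subtractf add_divide_distrib diff_divide_distrib)
  show ?thesis using up lo add diff const
  proof eventually_elim
    case (elim x)
    show ?case
    proof (rule tendstoI)
      fix e :: real assume "e > 0"
      have "\<forall>\<^sub>F n in sequentially. birkhoff_average n (\<lambda>x. u x + C) x < ?b x + C + e"
        using elim(1,3,5) \<open>e > 0\<close> by simp
      moreover have "\<forall>\<^sub>F n in sequentially. birkhoff_average n (\<lambda>x. C - u x) x < C - ?b x + e"
        using elim(2,4,5) \<open>e > 0\<close> by simp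
      ultimately show "\<forall>\<^sub>F n in sequentially. dist (birkhoff_average n u x) (?b x) < e"
        using eventually_ge_at_top[of 1]
        by eventually_elim (auto simp: shift dist_real_def abs_less_iff)
    qed
  qed
qed

text \<open>
  Each \<open>u - u \<circ> T\<^sup>k\<close> telescopes to the coboundary of \<open>\<Sum>j<k. u \<circ> T\<^sup>j\<close>; averaging over \<open>k < n\<close> gives \<open>g\<close>.
\<close>
lemma birkhoff_coboundary:
  fixes C :: real
  assumes [measurable]: "u \<in> borel_measurable M" and u: "\<And>x. \<bar>u x\<bar> \<le> C" and n: "n \<ge> 1"
  obtains g where "g \<in> borel_measurable M" "\<And>x. \<bar>g x\<bar> \<le> n * C"
    "\<And>x. u x - birkhoff_average n u x = g x - g (T x)"
proof
  define g where "g x = (\<Sum>k<n. \<Sum>j<k. u ((T ^^ j) x)) / n" for x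
  have [measurable]: "(\<lambda>x. u ((T ^^ k) x)) \<in> borel_measurable M" for k
    by (rule measurable_compose[OF T_pow_measurable assms(1)])
  show "g \<in> borel_measurable M" unfolding g_def by measurable
  have "0 \<le> C" using u[of undefined] by linarith
  show "\<bar>g x\<bar> \<le> n * C" for x
  proof -
    have "\<bar>\<Sum>k<n. \<Sum>j<k. u ((T ^^ j) x)\<bar> \<le> (\<Sum>k<n. \<Sum>j<k. C)"
      by (rule order_trans[OF sum_abs sum_mono], rule order_trans[OF sum_abs sum_mono], rule u)
    also have "\<dots> \<le> (\<Sum>k<n. n * C)"
      using \<open>0 \<le> C\<close> by (intro sum_mono) (auto intro!: mult_right_mono)
    also have "\<dots> = n * (n * C)" by simp
    finally show ?thesis using n by (simp add: g_def field_simps abs_divide)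
  qed
  show "u x - birkhoff_average n u x = g x - g (T x)" for x
  proof -
    have "(\<Sum>j<k. u ((T ^^ j) x)) - (\<Sum>j<k. u ((T ^^ j) (T x))) = u x - u ((T ^^ k) x)" for k
      by (induction k) (simp_all add: funpow_swap1[of T])
    then have "(\<Sum>k<n. \<Sum>j<k. u ((T ^^ j) x)) - (\<Sum>k<n. \<Sum>j<k. u ((T ^^ j) (T x)))
        = (\<Sum>k<n. u x - u ((T ^^ k) x))"
      by (simp add: sum_subtractf[symmetric])
    also have "\<dots> = n * u x - (\<Sum>k<n. u ((T ^^ k) x))" by (simp add: sum_subtractf)
    finally show ?thesis using n
      by (simp add: g_def birkhoff_average_def diff_divide_distrib[symmetric] field_simps)
  qed
qed

lemma mean_ergodic_bounded:
  assumes [measurable]: "u \<in> borel_measurable M" and u: "\<And>x. \<bar>u x\<bar> \<le> C"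
  shows "(\<lambda>n. \<integral>x. \<bar>birkhoff_average n u x - real_cond_exp M Inv u x\<bar> \<partial>M) \<longlonglongrightarrow> 0"
proof -
  have "0 \<le> C" using u[of undefined] by linarith
  have bound: "\<bar>birkhoff_average n u x\<bar> \<le> C" for n x
  proof (cases "n = 0")
    case False
    have "\<bar>\<Sum>k<n. u ((T ^^ k) x)\<bar> \<le> (\<Sum>k<n. C)"
      by (rule order_trans[OF sum_abs sum_mono]) (rule u)
    with False show ?thesis by (simp add: birkhoff_average_def field_simps abs_divide)
  qed (simp add: birkhoff_average_def \<open>0 \<le> C\<close>)
  note lim = birkhoff_theorem_bounded[OF assms(1) u]
  have "(\<lambda>n. \<integral>x. \<bar>birkhoff_average n u x - real_cond_exp M Inv u x\<bar> \<partial>M) \<longlonglongrightarrow> (\<integral>x. 0 \<partial>M)"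
  proof (rule integral_dominated_convergence[where w = "\<lambda>_. 2 * C"])
    show "AE x in M. (\<lambda>n. \<bar>birkhoff_average n u x - real_cond_exp M Inv u x\<bar>) \<longlonglongrightarrow> 0"
      using lim by eventually_elim (simp add: tendsto_rabs_zero LIM_zero)
    show "AE x in M. norm \<bar>birkhoff_average n u x - real_cond_exp M Inv u x\<bar> \<le> 2 * C" for n
      using lim
    proof eventually_elim
      case (elim x)
      have "\<bar>real_cond_exp M Inv u x\<bar> \<le> C"
        by (rule LIMSEQ_le_const2[OF tendsto_rabs[OF elim]]) (auto simp: bound)
      with bound[of n x] show ?case by simp
    qed
  qed auto
  then show ?thesis by simp
qed

lemma cond_exp_L1_contraction:
  assumes "integrable M f"
  shows "(\<integral>x. \<bar>real_cond_exp M Inv f x\<bar> \<partial>M) \<le> (\<integral>x. \<bar>f x\<bar> \<partial>M)"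
proof -
  have [measurable]: "f \<in> borel_measurable M" using assms by simp
  have "ennreal (\<integral>x. \<bar>real_cond_exp M Inv f x\<bar> \<partial>M) = (\<integral>\<^sup>+x. \<bar>real_cond_exp M Inv f x\<bar> \<partial>M)"
    by (rule nn_integral_eq_integral[symmetric]) (use inv.real_cond_exp_int(1)[OF assms] in auto)
  also have "\<dots> \<le> (\<integral>\<^sup>+x. nn_cond_exp M Inv (\<lambda>x. ennreal \<bar>f x\<bar>) x \<partial>M)"
    by (intro nn_integral_mono_AE inv.real_cond_exp_abs) simp
  also have "\<dots> = (\<integral>\<^sup>+x. \<bar>f x\<bar> \<partial>M)"
    using inv.nn_cond_exp_intg[of "\<lambda>_. 1" "\<lambda>x. ennreal \<bar>f x\<bar>"] by simp
  also have "\<dots> = ennreal (\<integral>x. \<bar>f x\<bar> \<partial>M)"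
    by (rule nn_integral_eq_integral) (use assms in auto)
  finally show ?thesis by simp
qed

text \<open>
  Truncate \<open>f\<close> to a bounded \<open>u\<close>. Then \<open>u\<close> minus its Birkhoff average is a bounded coboundary, the
  Birkhoff average is \<open>L\<^sup>1\<close>-close to the conditional expectation of \<open>u\<close>, and conditional expectation
  does not increase the truncation error.
\<close>
lemma invariant_plus_coboundary_dense:
  assumes f: "integrable M f" and "e > 0"
  obtains g r and C :: real where "g \<in> borel_measurable M" "\<And>x. \<bar>g x\<bar> \<le> C"
    "integrable M r" "(\<integral>x. \<bar>r x\<bar> \<partial>M) < e"
    "\<And>x. f x = real_cond_exp M Inv f x + (g x - g (T x)) + r x"
proof -
  have [measurable]: "f \<in> borel_measurable M" using f by simp
  define cut where "cut n x = truncate n (f x)" for n x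
  have [measurable]: "cut n \<in> borel_measurable M" for n unfolding cut_def truncate_def by measurable
  have cut_le: "\<bar>cut n x\<bar> \<le> real n" for n x
    by (simp add: cut_def abs_truncate_le)
  have "(\<lambda>n. \<integral>x. \<bar>f x - cut n x\<bar> \<partial>M) \<longlonglongrightarrow> 0"
    using truncate_tendsto_Lp[of 1 f M] f by (simp add: cut_def)
  then have "\<forall>\<^sub>F n in sequentially. (\<integral>x. \<bar>f x - cut n x\<bar> \<partial>M) < e / 3"
    using \<open>e > 0\<close> by (intro order_tendstoD(2)) auto
  then obtain K where K: "(\<integral>x. \<bar>f x - cut K x\<bar> \<partial>M) < e / 3"
    by (auto simp: eventually_sequentially)
  define u where "u = cut K"
  have [measurable]: "u \<in> borel_measurable M" by (simp add: u_def)
  have u: "\<bar>u x\<bar> \<le> real K" for x using cut_le by (simp add: u_def)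
  have u_int: "integrable M u" by (rule integrable_const_bound[where B = "real K"]) (use u in auto)
  have "\<forall>\<^sub>F n in sequentially. (\<integral>x. \<bar>birkhoff_average n u x - real_cond_exp M Inv u x\<bar> \<partial>M) < e / 3"
    using \<open>e > 0\<close> by (intro order_tendstoD(2)[OF mean_ergodic_bounded[OF _ u]]) auto
  from eventually_happens'[OF sequentially_bot eventually_conj[OF eventually_ge_at_top[of 1] this]]
  obtain n where n: "n \<ge> 1" "(\<integral>x. \<bar>birkhoff_average n u x - real_cond_exp M Inv u x\<bar> \<partial>M) < e / 3"
    by blast
  obtain g where g: "g \<in> borel_measurable M" "\<And>x. \<bar>g x\<bar> \<le> n * real K"
    "\<And>x. u x - birkhoff_average n u x = g x - g (T x)"
    using birkhoff_coboundary[of u "real K" n] u n(1) by auto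
  let ?E = "real_cond_exp M Inv"
  define r where "r x = (f x - u x) - (?E f x - ?E u x) + (birkhoff_average n u x - ?E u x)" for x
  have int: "integrable M (\<lambda>x. f x - u x)" "integrable M (\<lambda>x. ?E f x - ?E u x)"
    using f u_int inv.real_cond_exp_int(1) by auto
  have "integrable M (\<lambda>x. u x - (g x - g (T x)))"
  proof (rule integrable_const_bound[where B = "real K + 2 * (n * real K)"])
    show "AE x in M. norm (u x - (g x - g (T x))) \<le> real K + 2 * (n * real K)"
    proof (rule AE_I2)
      fix x
      show "norm (u x - (g x - g (T x))) \<le> real K + 2 * (n * real K)"
        using u[of x] g(2)[of x] g(2)[of "T x"] by simp
    qed
  qed (use g(1) in measurable)
  then have "integrable M (birkhoff_average n u)" by (simp add: g(3)[symmetric])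
  then have int3: "integrable M (\<lambda>x. birkhoff_average n u x - ?E u x)"
    using inv.real_cond_exp_int(1)[OF u_int] by auto
  have "integrable M r" 
    unfolding r_def[abs_def]
    by (intro Bochner_Integration.integrable_add Bochner_Integration.integrable_diff int int3)
  moreover have "(\<integral>x. \<bar>r x\<bar> \<partial>M) < e"
  proof -
    have eq: "AE x in M. ?E (\<lambda>x. f x - u x) x = ?E f x - ?E u x"
      by (rule inv.real_cond_exp_diff[OF f u_int])
    have "(\<integral>x. \<bar>?E f x - ?E u x\<bar> \<partial>M) = (\<integral>x. \<bar>?E (\<lambda>x. f x - u x) x\<bar> \<partial>M)"
      by (rule integral_cong_AE) (use eq in auto)
    also have "\<dots> \<le> (\<integral>x. \<bar>f x - u x\<bar> \<partial>M)" by (rule cond_exp_L1_contraction[OF int(1)])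
    also have "\<dots> < e / 3" using K by (simp add: u_def)
    finally have 2: "(\<integral>x. \<bar>?E f x - ?E u x\<bar> \<partial>M) < e / 3" .
    have "(\<integral>x. \<bar>r x\<bar> \<partial>M) \<le> (\<integral>x. \<bar>f x - u x\<bar> + \<bar>?E f x - ?E u x\<bar> + \<bar>birkhoff_average n u x - ?E u x\<bar> \<partial>M)"
    proof (rule integral_mono)
      show "integrable M (\<lambda>x. \<bar>r x\<bar>)" using \<open>integrable M r\<close> by simp
      show "integrable M (\<lambda>x. \<bar>f x - u x\<bar> + \<bar>?E f x - ?E u x\<bar> + \<bar>birkhoff_average n u x - ?E u x\<bar>)"
        by (intro Bochner_Integration.integrable_add integrable_abs int int3)
    qed (unfold r_def, linarith)
    also have "\<dots> = (\<integral>x. \<bar>f x - u x\<bar> \<partial>M) + (\<integral>x. \<bar>?E f x - ?E u x\<bar> \<partial>M) + (\<integral>x. \<bar>birkhoff_average n u x - ?E u x\<bar> \<partial>M)"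
      using int int3 by simp
    finally show ?thesis using K 2 n(2) by (simp add: u_def)
  qed
  moreover have "f x = ?E f x + (g x - g (T x)) + r x" for x
    by (simp add: g(3)[symmetric] r_def)
  ultimately show ?thesis using that g(1,2) by blast
qed

end

section \<open>The transfer operator of the cocycle\<close>

text \<open>
  Distinct points are separated by a member of a countable base, so the set where two Borel maps
  differ is a countable union of Borel sets.
\<close>
lemma standard_borel_eq_sets:
  assumes "standard_borel M" and [measurable]: "f \<in> measurable N M" "g \<in> measurable N M"
  shows "{x\<in>space N. f x = g x} \<in> sets N"
proof -
  obtain X where X: "completely_metrizable_space X" "second_countable X" "space M = topspace X"
    "sets M = sigma_sets (topspace X) {U. openin X U}"
    using assms(1) unfolding standard_borel_def by blast
  obtain B where B: "countable B" "\<And>V. V \<in> B \<Longrightarrow> openin X V"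
    "\<And>U x. openin X U \<Longrightarrow> x \<in> U \<Longrightarrow> \<exists>V\<in>B. x \<in> V \<and> V \<subseteq> U"
    using X(2) unfolding second_countable_def by metis
  have BM [measurable]: "V \<in> sets M" if "V \<in> B" for V
    using B(2)[OF that] X(4) by (auto intro: sigma_sets.Basic)
  have sep: "\<exists>V\<in>B. a \<in> V \<and> b \<notin> V" if "a \<in> space M" "b \<in> space M" "a \<noteq> b" for a b
  proof -
    have "t1_space X"
      using X(1) completely_metrizable_imp_metrizable_space metrizable_imp_t1_space by blast
    then have "\<exists>U. openin X U \<and> a \<in> U \<and> b \<notin> U"
      using that X(3) unfolding t1_space_def by simp
    then obtain U where U: "openin X U" "a \<in> U" "b \<notin> U" by (elim exE conjE)
    then obtain V where "V \<in> B" "a \<in> V" "V \<subseteq> U" using B(3)[OF U(1,2)] by (elim bexE conjE)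
    with U(3) show ?thesis by (intro bexI[of _ V]) auto
  qed
  have "{x\<in>space N. f x = g x} = space N - (\<Union>V\<in>B. {x\<in>space N. f x \<in> V \<and> g x \<notin> V})"
  proof (intro equalityI subsetI)
    fix x assume x: "x \<in> space N - (\<Union>V\<in>B. {x\<in>space N. f x \<in> V \<and> g x \<notin> V})"
    then have "f x \<in> space M" "g x \<in> space M"
      using measurable_space[OF assms(2)] measurable_space[OF assms(3)] by auto
    with sep[of "f x" "g x"] x show "x \<in> {x\<in>space N. f x = g x}" by auto
  qed auto
  also have "\<dots> \<in> sets N"
    using B(1) by (intro sets.Diff sets.top sets.countable_UN'') auto
  finally show ?thesis .
qed

locale backward_system = measure_preserving_system M T
  for M :: "'a measure" and T :: "'a \<Rightarrow> 'a" +
  fixes \<rho> :: "'a \<Rightarrow> 'a \<Rightarrow> real" and \<Gamma> :: "('a \<rightharpoonup> 'a) set"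
  assumes standard: "standard_borel M"
    and aper: "aperiodic M T"
    and cocycle: "radon_nikodym_cocycle M (orbit_rel M T) \<rho>"
    and countable_inverses: "countable \<Gamma>"
    and inverses: "complete_right_inverses M T \<Gamma>"
begin

text \<open>
  The weighted sum \<open>\<Sum>y\<in>S. \<rho>\<^sub>x(y) f(y)\<close> with values in \<open>[0, \<infinity>]\<close>, so that convergence is no issue.
\<close>
definition wsum :: "'a \<Rightarrow> 'a set \<Rightarrow> ('a \<Rightarrow> ennreal) \<Rightarrow> ennreal" where
  "wsum x S f = (\<integral>\<^sup>+y. ennreal (\<rho> x y) * f y \<partial>count_space S)"

definition preimages :: "nat \<Rightarrow> 'a \<Rightarrow> 'a set" where
  "preimages k x = {y\<in>space M. (T ^^ k) y = x}"

text \<open>The predual of the Koopman operator \<open>g \<mapsto> g \<circ> T\<close>, written with the cocycle.\<close>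
definition transfer :: "('a \<Rightarrow> ennreal) \<Rightarrow> 'a \<Rightarrow> ennreal" where
  "transfer f x = wsum x (preimages 1 x) f"

text \<open>
  The contribution of a single partial right inverse (or word) \<open>q\<close> to a weighted sum. Sums over
  points become sums over the fixed countable set of words, whose terms are measurable in \<open>x\<close>.
\<close>
definition pull :: "('a \<rightharpoonup> 'a) \<Rightarrow> ('a \<Rightarrow> ennreal) \<Rightarrow> 'a \<Rightarrow> ennreal" where
  "pull q f x = (case q x of None \<Rightarrow> 0 | Some y \<Rightarrow> ennreal (\<rho> x y) * f y)"

lemma preimages_orbit: "x \<in> space M \<Longrightarrow> y \<in> preimages k x \<Longrightarrow> (x, y) \<in> orbit_rel M T"
proof -
  assume "x \<in> space M" "y \<in> preimages k x"
  moreover from this have "(T ^^ 0) x = (T ^^ k) y" by (simp add: preimages_def)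
  ultimately show ?thesis unfolding orbit_rel_def preimages_def by blast
qed

lemma rho_pos: "(x, y) \<in> orbit_rel M T \<Longrightarrow> 0 < \<rho> x y"
  using cocycle by (auto simp: radon_nikodym_cocycle_def)

lemma rho_mult: "(x, y) \<in> orbit_rel M T \<Longrightarrow> (y, z) \<in> orbit_rel M T \<Longrightarrow> \<rho> x y * \<rho> y z = \<rho> x z"
  using cocycle unfolding radon_nikodym_cocycle_def by blast

lemma rho_refl: "x \<in> space M \<Longrightarrow> \<rho> x x = 1"
proof -
  assume "x \<in> space M"
  then have "(x, x) \<in> orbit_rel M T" by (auto simp: orbit_rel_def)
  from rho_mult[OF this this] rho_pos[OF this] show ?thesis by simp
qed

lemma rho_cocycle_preimages:
  assumes "x \<in> space M" "z \<in> preimages j x" "y \<in> preimages k z"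
  shows "ennreal (\<rho> x z) * ennreal (\<rho> z y) = ennreal (\<rho> x y)"
proof -
  have "z \<in> space M" using assms(2) by (simp add: preimages_def)
  with assms have E: "(x, z) \<in> orbit_rel M T" "(z, y) \<in> orbit_rel M T"
    by (auto intro: preimages_orbit)
  show ?thesis using rho_mult[OF E] rho_pos[OF E(1)]
    by (simp add: ennreal_mult'[symmetric])
qed

text \<open>
  By the cocycle identity the weights multiply along the path from \<open>x\<close> to a \<open>k\<close>-th preimage.
\<close>
lemma transfer_power_eq_wsum:
  assumes "x \<in> space M"
  shows "(transfer ^^ k) f x = wsum x (preimages k x) f"
  using assms
proof (induction k arbitrary: x)
  case 0
  then have "preimages 0 x = {x}" by (auto simp: preimages_def)
  then show ?case using 0 by (simp add: wsum_def nn_integral_count_space_finite rho_refl)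
next
  case (Suc k)
  have "(transfer ^^ Suc k) f x
      = (\<integral>\<^sup>+z. ennreal (\<rho> x z) * wsum z (preimages k z) f \<partial>count_space (preimages 1 x))"
  proof -
    have "(transfer ^^ Suc k) f x
      = (\<integral>\<^sup>+z. ennreal (\<rho> x z) * (transfer ^^ k) f z \<partial>count_space (preimages 1 x))"
      by (simp add: transfer_def[of "(transfer ^^ k) f"] wsum_def)
    also have "\<dots> = (\<integral>\<^sup>+z. ennreal (\<rho> x z) * wsum z (preimages k z) f \<partial>count_space (preimages 1 x))"
      by (intro nn_integral_cong arg_cong2[where f = "(*)"] refl Suc.IH) (simp add: preimages_def)
    finally show ?thesis .
  qed
  also have "\<dots> = (\<integral>\<^sup>+z. (\<integral>\<^sup>+y. ennreal (\<rho> x y) * f y \<partial>count_space {y\<in>space M. (T ^^ k) y = z})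
      \<partial>count_space (preimages 1 x))"
  proof (rule nn_integral_cong)
    fix z assume "z \<in> space (count_space (preimages 1 x))"
    then have z: "z \<in> preimages 1 x" by simp
    have "ennreal (\<rho> x z) * wsum z (preimages k z) f
      = (\<integral>\<^sup>+y. ennreal (\<rho> x z) * (ennreal (\<rho> z y) * f y) \<partial>count_space (preimages k z))"
      by (simp add: wsum_def nn_integral_cmult)
    also have "\<dots> = (\<integral>\<^sup>+y. ennreal (\<rho> x y) * f y \<partial>count_space (preimages k z))"
      by (intro nn_integral_cong)
        (simp add: mult.assoc[symmetric] rho_cocycle_preimages[OF Suc.prems z])
    finally show "ennreal (\<rho> x z) * wsum z (preimages k z) f
      = (\<integral>\<^sup>+y. ennreal (\<rho> x y) * f y \<partial>count_space {y\<in>space M. (T ^^ k) y = z})"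
      by (simp add: preimages_def)
  qed
  also have "\<dots> = wsum x {y\<in>space M. (T ^^ k) y \<in> preimages 1 x} f"
    unfolding wsum_def by (rule nn_integral_count_space_fibres)
  also have "{y\<in>space M. (T ^^ k) y \<in> preimages 1 x} = preimages (Suc k) x"
    using measurable_space[OF T_pow_measurable] by (auto simp: preimages_def)
  finally show ?case .
qed

lemma inverse_graph:
  assumes "\<gamma> \<in> \<Gamma>" "\<gamma> x = Some y"
  shows "x \<in> space M" "y \<in> space M" "T y = x"
proof -
  have "dom \<gamma> \<in> sets M"
    using inverses assms(1) by (auto simp: complete_right_inverses_def borel_partial_def)
  then show x: "x \<in> space M" using sets.sets_into_space assms(2) by blast
  have "y \<in> T -` {x} \<inter> space M"
    using inverses x assms unfolding complete_right_inverses_def by blast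
  then show "y \<in> space M" "T y = x" by auto
qed

lemma inverse_unique:
  assumes "\<gamma> \<in> \<Gamma>" "\<delta> \<in> \<Gamma>" "\<gamma> x = Some y" "\<delta> x = Some y"
  shows "\<gamma> = \<delta>"
proof (rule ccontr)
  assume "\<gamma> \<noteq> \<delta>"
  then have "disjnt (Map.graph \<gamma>) (Map.graph \<delta>)"
    using inverses assms by (auto simp: complete_right_inverses_def pairwise_def)
  moreover have "(x, y) \<in> Map.graph \<gamma>" "(x, y) \<in> Map.graph \<delta>"
    using assms by (auto simp: Map.graph_def)
  ultimately show False by (auto simp: disjnt_def)
qed

lemma inverse_exists: "y \<in> space M \<Longrightarrow> \<exists>\<gamma>\<in>\<Gamma>. \<gamma> (T y) = Some y"
proof -
  assume y: "y \<in> space M"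
  then have "y \<in> T -` {T y} \<inter> space M" by simp
  then show ?thesis using inverses T_space[OF y] unfolding complete_right_inverses_def by blast
qed

lemma inverse_borel:
  assumes "\<gamma> \<in> \<Gamma>"
  shows "dom \<gamma> \<in> sets M" "(\<lambda>x. the (\<gamma> x)) \<in> measurable (restrict_space M (dom \<gamma>)) M"
  using assms inverses by (auto simp: complete_right_inverses_def borel_partial_def)

lemma inverse_injection:
  assumes "\<gamma> \<in> \<Gamma>"
  shows "borel_partial_injection_in M (orbit_rel M T) \<gamma>"
proof -
  have "inj_on \<gamma> (dom \<gamma>)"
  proof (rule inj_onI)
    fix x x' assume *: "x \<in> dom \<gamma>" "x' \<in> dom \<gamma>" "\<gamma> x = \<gamma> x'"
    then obtain y where "\<gamma> x = Some y" "\<gamma> x' = Some y" by auto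
    with inverse_graph(3)[OF assms] show "x = x'" by metis
  qed
  moreover have "Map.graph \<gamma> \<subseteq> orbit_rel M T"
  proof safe
    fix x y assume "(x, y) \<in> Map.graph \<gamma>"
    then have "\<gamma> x = Some y" by (simp add: Map.graph_def)
    then have "x \<in> space M" "y \<in> preimages 1 x"
      using inverse_graph[OF assms] by (auto simp: preimages_def)
    then show "(x, y) \<in> orbit_rel M T" by (rule preimages_orbit)
  qed
  ultimately show ?thesis
    using inverse_borel[OF assms] by (simp add: borel_partial_injection_in_def borel_partial_def)
qed

text \<open>
  A point \<open>y\<close> is in the range of \<open>\<gamma>\<close> iff \<open>\<gamma> (T y) = y\<close>, and equality of Borel maps is a Borel
  condition.
\<close>
lemma inverse_ran_sets [measurable]:
  assumes "\<gamma> \<in> \<Gamma>"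
  shows "ran \<gamma> \<in> sets M"
proof -
  define D where "D = T -` dom \<gamma> \<inter> space M"
  have D: "D \<in> sets M"
    using inverse_borel(1)[OF assms] unfolding D_def by (rule measurable_sets[OF T_measurable])
  have "T \<in> measurable (restrict_space M D) (restrict_space M (dom \<gamma>))"
    by (rule measurable_restrict_space3) (auto simp: D_def)
  from measurable_compose[OF this inverse_borel(2)[OF assms]]
  have "(\<lambda>y. the (\<gamma> (T y))) \<in> measurable (restrict_space M D) M" .
  moreover have "(\<lambda>y. y) \<in> measurable (restrict_space M D) M"
    by (rule measurable_restrict_space1) simp
  ultimately have "{y\<in>space (restrict_space M D). the (\<gamma> (T y)) = y} \<in> sets (restrict_space M D)"
    by (rule standard_borel_eq_sets[OF standard])
  moreover have "{y\<in>space (restrict_space M D). the (\<gamma> (T y)) = y} = ran \<gamma>"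
  proof (intro equalityI subsetI)
    fix y assume "y \<in> ran \<gamma>"
    then obtain x where x: "\<gamma> x = Some y" by (auto simp: ran_def)
    from inverse_graph[OF assms x] x show "y \<in> {y\<in>space (restrict_space M D). the (\<gamma> (T y)) = y}"
      by (auto simp: space_restrict_space D_def)
  next
    fix y assume "y \<in> {y\<in>space (restrict_space M D). the (\<gamma> (T y)) = y}"
    then show "y \<in> ran \<gamma>" by (auto simp: space_restrict_space D_def ran_def)
  qed
  ultimately show ?thesis using D by (simp add: sets_restrict_space_iff)
qed

lemma pull_measurable:
  assumes dom: "dom q \<inter> space M \<in> sets M"
    and q: "(\<lambda>x. the (q x)) \<in> measurable (restrict_space M (dom q)) M"
    and E: "\<And>x y. x \<in> space M \<Longrightarrow> q x = Some y \<Longrightarrow> (x, y) \<in> orbit_rel M T"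
    and f: "f \<in> borel_measurable M"
  shows "pull q f \<in> borel_measurable M"
proof -
  let ?N = "restrict_space M (dom q)"
  have "(\<lambda>x. (x, the (q x))) \<in> measurable ?N (restrict_space (M \<Otimes>\<^sub>M M) (orbit_rel M T))"
  proof (rule measurable_restrict_space2)
    show "(\<lambda>x. (x, the (q x))) \<in> space ?N \<rightarrow> orbit_rel M T"
      using E by (auto simp: space_restrict_space)
    show "(\<lambda>x. (x, the (q x))) \<in> measurable ?N (M \<Otimes>\<^sub>M M)"
      by (intro measurable_Pair q) (simp add: measurable_restrict_space1)
  qed
  moreover have "(\<lambda>(x, y). \<rho> x y) \<in> borel_measurable (restrict_space (M \<Otimes>\<^sub>M M) (orbit_rel M T))"
    using cocycle by (simp add: radon_nikodym_cocycle_def)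
  ultimately have [measurable]: "(\<lambda>x. \<rho> x (the (q x))) \<in> borel_measurable ?N"
    by (rule measurable_compose[where f = "\<lambda>x. (x, the (q x))" and g = "\<lambda>(x, y). \<rho> x y", simplified])
  have [measurable]: "(\<lambda>x. f (the (q x))) \<in> borel_measurable ?N"
    by (rule measurable_compose[OF q f])
  have "(\<lambda>x. ennreal (\<rho> x (the (q x))) * f (the (q x))) \<in> borel_measurable ?N"
    by measurable
  then have "(\<lambda>x. ennreal (\<rho> x (the (q x))) * f (the (q x)) * indicator (dom q) x)
      \<in> borel_measurable M"
    using dom by (simp add: borel_measurable_restrict_space_iff_ennreal)
  also have "(\<lambda>x. ennreal (\<rho> x (the (q x))) * f (the (q x)) * indicator (dom q) x) = pull q f"
    by (auto simp: pull_def fun_eq_iff indicator_def split: option.split)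
  finally show ?thesis .
qed

lemma inverse_pull_measurable [measurable]:
  assumes "\<gamma> \<in> \<Gamma>" "f \<in> borel_measurable M"
  shows "pull \<gamma> f \<in> borel_measurable M"
proof (rule pull_measurable[OF _ inverse_borel(2)[OF assms(1)] _ assms(2)])
  show "dom \<gamma> \<inter> space M \<in> sets M" using inverse_borel(1)[OF assms(1)] by simp
  show "(x, y) \<in> orbit_rel M T" if "\<gamma> x = Some y" for x y
    using inverse_injection[OF assms(1)] that
    by (auto simp: borel_partial_injection_in_def Map.graph_def)
qed

lemma nn_integral_inverse_pull_indicator:
  assumes \<gamma>: "\<gamma> \<in> \<Gamma>" and [measurable]: "A \<in> sets M"
  shows "(\<integral>\<^sup>+x. pull \<gamma> (indicator A) x \<partial>M) = emeasure M (A \<inter> ran \<gamma>)"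
proof -
  let ?g = "\<lambda>x. indicator A (the (\<gamma> x)) * \<rho> x (the (\<gamma> x)) :: real"
  have "set_integrable M (dom \<gamma>) ?g \<and> (LINT y:ran \<gamma>|M. indicator A y) = (LINT x:dom \<gamma>|M. ?g x)"
    using cocycle inverse_injection[OF \<gamma>] unfolding radon_nikodym_cocycle_def
    by (auto simp: integrable_indicator_iff less_top[symmetric])
  then have int: "integrable M (\<lambda>x. indicator (dom \<gamma>) x * ?g x)"
    and eq: "(LINT y:ran \<gamma>|M. indicator A y) = (\<integral>x. indicator (dom \<gamma>) x * ?g x \<partial>M)"
    by (auto simp: set_integrable_def set_lebesgue_integral_def)
  have pos: "0 \<le> indicator (dom \<gamma>) x * ?g x" for x
  proof (cases "\<gamma> x")
    case (Some y)
    have "(x, y) \<in> orbit_rel M T" using inverse_injection[OF \<gamma>] Some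
      by (auto simp: borel_partial_injection_in_def Map.graph_def)
    from rho_pos[OF this] Some show ?thesis by auto
  qed (simp add: domIff)
  have "(\<integral>\<^sup>+x. pull \<gamma> (indicator A) x \<partial>M) = (\<integral>\<^sup>+x. ennreal (indicator (dom \<gamma>) x * ?g x) \<partial>M)"
    by (intro nn_integral_cong)
      (auto simp: pull_def indicator_def split: option.split)
  also have "\<dots> = ennreal (\<integral>x. indicator (dom \<gamma>) x * ?g x \<partial>M)"
    by (rule nn_integral_eq_integral[OF int]) (simp add: pos)
  also have "\<dots> = ennreal (\<integral>y. indicator (A \<inter> ran \<gamma>) y \<partial>M)"
    unfolding eq[symmetric] set_lebesgue_integral_def
    by (intro arg_cong[where f = ennreal] Bochner_Integration.integral_cong) (auto simp: indicator_def)
  also have "\<dots> = emeasure M (A \<inter> ran \<gamma>)"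
    using \<gamma> sets.sets_into_space[OF inverse_ran_sets[OF \<gamma>]]
    by (simp add: emeasure_eq_measure Int_absorb2 le_infI2)
  finally show ?thesis .
qed

lemma pull_cmult: "pull q (\<lambda>x. c * f x) x = c * pull q f x"
  by (auto simp: pull_def ac_simps split: option.split)

lemma pull_add: "pull q (\<lambda>x. f x + g x) x = pull q f x + pull q g x"
  by (auto simp: pull_def distrib_left split: option.split)

lemma pull_SUP: "pull q (\<lambda>x. SUP i. u i x) x = (SUP i::nat. pull q (u i) x)"
  by (auto simp: pull_def SUP_mult_left_ennreal split: option.split)

text \<open>
  The change of variables formula of the cocycle, extended from integrable functions to all
  nonnegative ones.
\<close>
lemma nn_integral_inverse_pull:
  assumes \<gamma>: "\<gamma> \<in> \<Gamma>" and "f \<in> borel_measurable M"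
  shows "(\<integral>\<^sup>+x. pull \<gamma> f x \<partial>M) = (\<integral>\<^sup>+y. f y * indicator (ran \<gamma>) y \<partial>M)"
  using assms(2)
proof (induction rule: borel_measurable_induct)
  case (cong f g)
  have "pull \<gamma> f x = pull \<gamma> g x" for x
    using cong(3) inverse_graph(2)[OF \<gamma>] by (auto simp: pull_def split: option.split)
  moreover have "(\<integral>\<^sup>+y. f y * indicator (ran \<gamma>) y \<partial>M) = (\<integral>\<^sup>+y. g y * indicator (ran \<gamma>) y \<partial>M)"
    using cong(3) by (intro nn_integral_cong) simp
  ultimately show ?case using cong by simp
next
  case (set A)
  have "(\<integral>\<^sup>+y. indicator A y * indicator (ran \<gamma>) y \<partial>M) = (\<integral>\<^sup>+y. indicator (A \<inter> ran \<gamma>) y \<partial>M)"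
    by (intro nn_integral_cong) (simp add: indicator_def)
  also have "\<dots> = emeasure M (A \<inter> ran \<gamma>)"
    using set inverse_ran_sets[OF \<gamma>] by simp
  finally show ?case using nn_integral_inverse_pull_indicator[OF \<gamma> set] by simp
next
  case (mult u c)
  then show ?case using \<gamma>
    by (simp add: pull_cmult nn_integral_cmult mult.assoc)
next
  case (add u v)
  then show ?case using \<gamma>
    by (simp add: pull_add nn_integral_add distrib_right)
next
  case (seq U)
  have 1: "(\<integral>\<^sup>+x. pull \<gamma> (\<lambda>x. SUP i. U i x) x \<partial>M) = (SUP i. \<integral>\<^sup>+x. pull \<gamma> (U i) x \<partial>M)"
    unfolding pull_SUP
  proof (rule nn_integral_monotone_convergence_SUP)
    show "incseq (\<lambda>i. pull \<gamma> (U i))"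
      using seq(3) by (auto simp: incseq_def le_fun_def pull_def split: option.split intro!: mult_left_mono)
  qed (use \<gamma> seq in simp)
  have 2: "(\<integral>\<^sup>+y. (SUP i. U i y) * indicator (ran \<gamma>) y \<partial>M) = (SUP i. \<integral>\<^sup>+y. U i y * indicator (ran \<gamma>) y \<partial>M)"
    unfolding SUP_mult_right_ennreal
  proof (rule nn_integral_monotone_convergence_SUP)
    show "incseq (\<lambda>i y. U i y * indicator (ran \<gamma>) y)"
      using seq(3) by (auto simp: incseq_def le_fun_def intro!: mult_right_mono)
  qed (use \<gamma> seq in simp)
  show ?case using 1 2 seq by (simp add: image_image SUP_apply[abs_def])
qed

lemma word_map_simps [simp]:
  "word_map [] = Some" "word_map (\<gamma> # t) = \<gamma> \<circ>\<^sub>m word_map t"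
  by (simp_all add: word_map_def)

lemma word_map_preimage:
  assumes "t \<in> lists \<Gamma>" "x \<in> space M" "word_map t x = Some y"
  shows "y \<in> preimages (length t) x"
  using assms
proof (induction t arbitrary: y rule: list.induct)
  case (Cons \<gamma> t)
  then obtain z where z: "word_map t x = Some z" "\<gamma> z = Some y"
    by (auto simp: map_comp_Some_iff)
  with Cons have "z \<in> preimages (length t) x" by simp
  moreover have "\<gamma> \<in> \<Gamma>" using Cons.prems(1) by simp
  note inverse_graph[OF this z(2)]
  ultimately show ?case
    by (simp add: preimages_def funpow_swap1)
qed (simp add: preimages_def)

text \<open>
  The value \<open>y\<close> of a word at \<open>x\<close> determines the word: its length is the number of steps from \<open>y\<close> to
  \<open>x\<close>, which is unique by aperiodicity, and its letters are determined one by one because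
  different right inverses have disjoint graphs.
\<close>
lemma word_map_inj:
  assumes "s \<in> lists \<Gamma>" "t \<in> lists \<Gamma>" "x \<in> space M" "word_map s x = Some y" "word_map t x = Some y"
  shows "s = t"
proof -
  have no_return: "length t \<le> length s"
    if "y \<in> preimages (length s) x" "y \<in> preimages (length t) x" for s t :: "('a \<rightharpoonup> 'a) list"
  proof (rule ccontr)
    assume "\<not> length t \<le> length s"
    then obtain d where d: "length t = d + length s" "d \<ge> 1"
      by (intro that[of "length t - length s"]) auto
    then have "(T ^^ d) ((T ^^ length s) y) = (T ^^ length t) y" by (simp add: funpow_add)
    then have "(T ^^ d) x = x" using that by (simp add: preimages_def)
    then show False using aper assms(3) d(2) by (auto simp: aperiodic_def)
  qed
  have "length s = length t"
    using no_return[of s t] no_return[of t s] assms word_map_preimage by (meson le_antisym)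
  then show ?thesis using assms
  proof (induction s t arbitrary: y rule: list_induct2)
    case (Cons \<gamma> s \<delta> t)
    obtain z where z: "word_map s x = Some z" "\<gamma> z = Some y"
      using Cons.prems by (auto simp: map_comp_Some_iff)
    obtain w where w: "word_map t x = Some w" "\<delta> w = Some y"
      using Cons.prems by (auto simp: map_comp_Some_iff)
    have \<Gamma>: "\<gamma> \<in> \<Gamma>" "\<delta> \<in> \<Gamma>" using Cons.prems by auto
    have "z = w" using inverse_graph(3)[OF \<Gamma>(1) z(2)] inverse_graph(3)[OF \<Gamma>(2) w(2)] by simp
    have "\<gamma> = \<delta>"
      using inverse_unique[OF \<Gamma> z(2)] w(2) \<open>z = w\<close> by simp
    moreover have "s = t"
      using Cons.IH[of z] Cons.prems z(1) w(1) \<open>z = w\<close> by simp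
    ultimately show ?case by simp
  qed simp
qed

lemma word_map_borel:
  assumes "t \<in> lists \<Gamma>"
  shows "dom (word_map t) \<inter> space M \<in> sets M \<and>
    (\<lambda>x. the (word_map t x)) \<in> measurable (restrict_space M (dom (word_map t))) M"
  using assms
proof (induction t rule: list.induct)
  case Nil
  have "(\<lambda>x. the (word_map [] x)) \<in> measurable M M" by simp
  from measurable_restrict_space1[OF this] show ?case by (simp add: dom_def)
next
  case (Cons \<gamma> t)
  let ?q = "word_map t" and ?r = "word_map (\<gamma> # t)"
  let ?N = "restrict_space M (dom ?q)"
  have \<gamma>: "\<gamma> \<in> \<Gamma>" and dom: "dom ?q \<inter> space M \<in> sets M"
    and q: "(\<lambda>x. the (?q x)) \<in> measurable ?N M"
    using Cons by auto
  have r: "dom ?r = {x\<in>dom ?q. the (?q x) \<in> dom \<gamma>}"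
    by (auto simp: map_comp_def dom_def split: option.splits)
  have "(\<lambda>x. the (?q x)) -` dom \<gamma> \<inter> space ?N \<in> sets ?N"
    by (rule measurable_sets[OF q inverse_borel(1)[OF \<gamma>]])
  moreover have "(\<lambda>x. the (?q x)) -` dom \<gamma> \<inter> space ?N = dom ?r \<inter> space M"
    unfolding r by (auto simp: space_restrict_space)
  ultimately have 1: "dom ?r \<inter> space M \<in> sets M"
    using dom by (simp add: sets_restrict_space_iff)
  have "(\<lambda>x. the (?q x)) \<in> measurable (restrict_space M (dom ?r)) M"
    by (rule measurable_restrict_mono[OF q]) (unfold r, blast)
  then have "(\<lambda>x. the (?q x)) \<in> measurable (restrict_space M (dom ?r)) (restrict_space M (dom \<gamma>))"
    by (intro measurable_restrict_space2) (unfold r, auto simp: space_restrict_space)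
  from measurable_compose[OF this inverse_borel(2)[OF \<gamma>]]
  have "(\<lambda>x. the (\<gamma> (the (?q x)))) \<in> measurable (restrict_space M (dom ?r)) M" .
  also have "?this \<longleftrightarrow> (\<lambda>x. the (?r x)) \<in> measurable (restrict_space M (dom ?r)) M"
    by (rule measurable_cong) (auto simp: space_restrict_space map_comp_def split: option.splits)
  finally show ?case using 1 by simp
qed

text \<open>Since words act injectively, summing over words counts every point of the orbit once.\<close>
lemma wsum_word_orbit:
  assumes J: "J \<subseteq> lists \<Gamma>" and x: "x \<in> space M"
  shows "wsum x (word_orbit J x) f = (\<integral>\<^sup>+t. pull (word_map t) f x \<partial>count_space J)"
proof -
  let ?D = "{t\<in>J. word_map t x \<noteq> None}"
  have "inj_on (\<lambda>t. the (word_map t x)) ?D"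
  proof (rule inj_onI)
    fix s t assume *: "s \<in> ?D" "t \<in> ?D" "the (word_map s x) = the (word_map t x)"
    then obtain y where "word_map s x = Some y" "word_map t x = Some y" by auto
    with * J x show "s = t" by (intro word_map_inj) auto
  qed
  moreover have "(\<lambda>t. the (word_map t x)) ` ?D = word_orbit J x"
    by (force simp: word_orbit_def image_iff)
  ultimately have "bij_betw (\<lambda>t. the (word_map t x)) ?D (word_orbit J x)"
    by (rule bij_betw_imageI)
  from nn_integral_bij_count_space[OF this, of "\<lambda>y. ennreal (\<rho> x y) * f y"]
  have "wsum x (word_orbit J x) f
      = (\<integral>\<^sup>+t. ennreal (\<rho> x (the (word_map t x))) * f (the (word_map t x)) \<partial>count_space ?D)"
    by (simp add: wsum_def)
  also have "\<dots> = (\<integral>\<^sup>+t. pull (word_map t) f x \<partial>count_space ?D)"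
    by (intro nn_integral_cong) (auto simp: pull_def)
  also have "\<dots> = (\<integral>\<^sup>+t. pull (word_map t) f x \<partial>count_space J)"
    by (rule nn_integral_count_space_eq) (auto simp: pull_def)
  finally show ?thesis .
qed

lemma countable_words: "J \<subseteq> lists \<Gamma> \<Longrightarrow> countable J"
  using countable_lists[OF countable_inverses] countable_subset by blast

lemma countable_word_orbit:
  assumes "J \<subseteq> lists \<Gamma>"
  shows "countable (word_orbit J x)"
proof (rule countable_subset)
  show "word_orbit J x \<subseteq> (\<lambda>t. the (word_map t x)) ` J"
    by (force simp: word_orbit_def image_iff)
  show "countable ((\<lambda>t. the (word_map t x)) ` J)"
    using countable_words[OF assms] by simp
qed

lemma wsum_word_orbit_measurable:
  assumes J: "J \<subseteq> lists \<Gamma>" and f: "f \<in> borel_measurable M"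
  shows "(\<lambda>x. wsum x (word_orbit J x) f) \<in> borel_measurable M"
proof -
  have pull: "pull (word_map t) f \<in> borel_measurable M" if "t \<in> J" for t
  proof -
    have t: "t \<in> lists \<Gamma>" using J that by auto
    show ?thesis
    proof (rule pull_measurable[OF _ _ _ f])
      show "(x, y) \<in> orbit_rel M T" if "x \<in> space M" "word_map t x = Some y" for x y
        using preimages_orbit[OF that(1) word_map_preimage[OF t that]] .
    qed (use word_map_borel[OF t] in simp_all)
  qed
  interpret J: sigma_finite_measure "count_space J"
    using countable_words[OF J] by (rule sigma_finite_measure_count_space_countable)
  have "(\<lambda>(t, x). pull (word_map t) f x) \<in> borel_measurable (count_space J \<Otimes>\<^sub>M M)"
    using countable_words[OF J] by (rule measurable_pair_measure_countable1) (simp add: pull)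
  then have "(\<lambda>(x, t). pull (word_map t) f x) \<in> borel_measurable (M \<Otimes>\<^sub>M count_space J)"
    by (subst (asm) measurable_pair_swap_iff) (simp add: case_prod_beta')
  then have "(\<lambda>x. \<integral>\<^sup>+t. pull (word_map t) f x \<partial>count_space J) \<in> borel_measurable M"
    by (rule J.borel_measurable_nn_integral)
  then show ?thesis
    by (subst measurable_cong[OF wsum_word_orbit[OF J]])
qed

lemma preimages_eq_word_orbit:
  assumes "x \<in> space M"
  shows "preimages 1 x = word_orbit ((\<lambda>\<gamma>. [\<gamma>]) ` \<Gamma>) x"
proof -
  have "preimages 1 x = T -` {x} \<inter> space M" by (auto simp: preimages_def)
  also have "\<dots> = {y. \<exists>\<gamma>\<in>\<Gamma>. \<gamma> x = Some y}"
    using inverses assms by (simp add: complete_right_inverses_def)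
  finally show ?thesis by (simp add: word_orbit_def map_comp_def)
qed

lemma transfer_eq_pull:
  assumes "x \<in> space M"
  shows "transfer f x = (\<integral>\<^sup>+\<gamma>. pull \<gamma> f x \<partial>count_space \<Gamma>)"
proof -
  have "transfer f x = (\<integral>\<^sup>+t. pull (word_map t) f x \<partial>count_space ((\<lambda>\<gamma>. [\<gamma>]) ` \<Gamma>))"
    unfolding transfer_def preimages_eq_word_orbit[OF assms]
    by (rule wsum_word_orbit) (use assms in auto)
  also have "\<dots> = (\<integral>\<^sup>+\<gamma>. pull (word_map [\<gamma>]) f x \<partial>count_space \<Gamma>)"
    by (rule nn_integral_bij_count_space[symmetric]) (auto intro!: bij_betw_imageI inj_onI)
  finally show ?thesis by (simp add: map_comp_def pull_def)
qed

lemma transfer_measurable [measurable]: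
  assumes "f \<in> borel_measurable M"
  shows "transfer f \<in> borel_measurable M"
proof -
  have "(\<lambda>x. wsum x (word_orbit ((\<lambda>\<gamma>. [\<gamma>]) ` \<Gamma>) x) f) \<in> borel_measurable M"
    using assms by (intro wsum_word_orbit_measurable) auto
  then show ?thesis
    by (subst measurable_cong[of _ _ "\<lambda>x. wsum x (word_orbit ((\<lambda>\<gamma>. [\<gamma>]) ` \<Gamma>) x) f"])
       (simp_all only: transfer_def preimages_eq_word_orbit)
qed

text \<open>The ranges of the right inverses partition the space.\<close>
lemma nn_integral_transfer:
  assumes [measurable]: "f \<in> borel_measurable M"
  shows "(\<integral>\<^sup>+x. transfer f x \<partial>M) = (\<integral>\<^sup>+x. f x \<partial>M)"
proof -
  have "(\<integral>\<^sup>+x. transfer f x \<partial>M) = (\<integral>\<^sup>+x. (\<integral>\<^sup>+\<gamma>. pull \<gamma> f x \<partial>count_space \<Gamma>) \<partial>M)"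
    by (intro nn_integral_cong transfer_eq_pull)
  also have "\<dots> = (\<integral>\<^sup>+\<gamma>. (\<integral>\<^sup>+y. f y * indicator (ran \<gamma>) y \<partial>M) \<partial>count_space \<Gamma>)"
    using countable_inverses
    by (subst nn_integral_count_space_nn_integral, simp, simp)
       (rule nn_integral_cong, simp add: nn_integral_inverse_pull)
  also have "\<dots> = (\<integral>\<^sup>+y. (\<integral>\<^sup>+\<gamma>. f y * indicator (ran \<gamma>) y \<partial>count_space \<Gamma>) \<partial>M)"
    using countable_inverses
    by (subst nn_integral_count_space_nn_integral) auto
  also have "\<dots> = (\<integral>\<^sup>+y. f y \<partial>M)"
  proof (rule nn_integral_cong)
    fix y assume y: "y \<in> space M"
    obtain \<gamma> where \<gamma>: "\<gamma> \<in> \<Gamma>" "\<gamma> (T y) = Some y" using inverse_exists[OF y] by blast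
    have "\<delta> = \<gamma>" if \<delta>: "\<delta> \<in> \<Gamma>" "y \<in> ran \<delta>" for \<delta>
    proof -
      obtain x where x: "\<delta> x = Some y" using \<delta>(2) by (auto simp: ran_def)
      with inverse_graph(3)[OF \<delta>(1) x] have "\<delta> (T y) = Some y" by simp
      with inverse_unique[OF \<delta>(1) \<gamma>(1) _ \<gamma>(2)] show ?thesis by simp
    qed
    then have zero: "f y * indicator (ran \<delta>) y = 0" if "\<delta> \<in> \<Gamma>" "\<delta> \<notin> {\<gamma>}" for \<delta>
      using that by (metis indicator_simps(2) mult_zero_right singletonI)
    have "y \<in> ran \<gamma>" using \<gamma>(2) by (auto simp: ran_def)
    have "(\<integral>\<^sup>+\<delta>. f y * indicator (ran \<delta>) y \<partial>count_space \<Gamma>)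
        = (\<Sum>\<delta>\<in>{\<gamma>}. f y * indicator (ran \<delta>) y)"
      using \<gamma>(1) by (intro nn_integral_count_space' zero) simp_all
    also have "\<dots> = f y" using \<open>y \<in> ran \<gamma>\<close> by simp
    finally show "(\<integral>\<^sup>+\<delta>. f y * indicator (ran \<delta>) y \<partial>count_space \<Gamma>) = f y" .
  qed
  finally show ?thesis .
qed

lemma transfer_mult_invariant:
  "transfer (\<lambda>y. g (T y) * f y) x = g x * transfer f x"
proof -
  have "transfer (\<lambda>y. g (T y) * f y) x
      = (\<integral>\<^sup>+y. g x * (ennreal (\<rho> x y) * f y) \<partial>count_space (preimages 1 x))"
    unfolding transfer_def wsum_def
    by (intro nn_integral_cong) (auto simp: preimages_def ac_simps)
  then show ?thesis by (simp add: transfer_def wsum_def nn_integral_cmult)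
qed

text \<open>
  The integral of \<open>transfer 1\<close> over \<open>A\<close> is the measure of \<open>T\<^sup>-\<^sup>1 A\<close>, hence that of \<open>A\<close>.
\<close>
lemma transfer_one: "AE x in M. transfer (\<lambda>_. 1) x = 1"
proof (rule density_unique2)
  fix A assume A[measurable]: "A \<in> sets M"
  have "(\<integral>\<^sup>+x. transfer (\<lambda>_. 1) x * indicator A x \<partial>M)
      = (\<integral>\<^sup>+x. transfer (\<lambda>y. indicator A (T y) * 1) x \<partial>M)"
    by (intro nn_integral_cong, subst transfer_mult_invariant) (rule mult.commute)
  also have "\<dots> = (\<integral>\<^sup>+x. indicator A (T x) \<partial>M)"
    by (subst nn_integral_transfer) simp_all
  also have "\<dots> = (\<integral>\<^sup>+x. 1 * indicator A x \<partial>M)"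
    by (subst nn_integral_T) auto
  finally show "(\<integral>\<^sup>+x\<in>A. transfer (\<lambda>_. 1) x \<partial>M) = (\<integral>\<^sup>+x\<in>A. 1 \<partial>M)" .
qed auto

lemma transfer_pow_measurable [measurable]:
  "f \<in> borel_measurable M \<Longrightarrow> (transfer ^^ k) f \<in> borel_measurable M"
  by (induction k) auto

lemma nn_integral_transfer_pow:
  "f \<in> borel_measurable M \<Longrightarrow> (\<integral>\<^sup>+x. (transfer ^^ k) f x \<partial>M) = (\<integral>\<^sup>+x. f x \<partial>M)"
  by (induction k) (auto simp: nn_integral_transfer)

text \<open>
  If \<open>N\<close> is null then the powers of the transfer operator, applied to its indicator, have integral
  zero and so vanish almost everywhere. As the weights are positive, the backward orbit of
  almost every point avoids \<open>N\<close>.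
\<close>
lemma AE_backward_orbit:
  assumes "AE z in M. Q z"
  shows "AE x in M. \<forall>k. \<forall>y\<in>preimages k x. Q y"
proof -
  obtain N where N: "{x\<in>space M. \<not> Q x} \<subseteq> N" "emeasure M N = 0" "N \<in> sets M"
    using AE_E[OF assms] by auto
  have "AE x in M. \<forall>k. (transfer ^^ k) (indicator N) x = 0"
    unfolding AE_all_countable
  proof
    fix k
    have "(\<integral>\<^sup>+x. (transfer ^^ k) (indicator N) x \<partial>M) = 0"
      using N by (simp add: nn_integral_transfer_pow)
    then show "AE x in M. (transfer ^^ k) (indicator N) x = 0"
      using N(3) by (subst (asm) nn_integral_0_iff_AE) auto
  qed
  then show ?thesis
  proof (rule AE_mp[OF _ AE_I2], safe)
    fix x k y assume x: "x \<in> space M" and 0: "\<forall>k. (transfer ^^ k) (indicator N) x = 0"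
      and y: "y \<in> preimages k x"
    have "wsum x (preimages k x) (indicator N) = 0"
      using 0 transfer_power_eq_wsum[OF x, of k "indicator N"] by simp
    then have "\<forall>y\<in>preimages k x. ennreal (\<rho> x y) * indicator N y = 0"
      by (simp add: wsum_def nn_integral_0_iff_AE AE_count_space)
    with y rho_pos[OF preimages_orbit[OF x y]] have "y \<notin> N"
      by (auto simp: ennreal_eq_0_iff)
    with N(1) y show "Q y" by (auto simp: preimages_def)
  qed
qed

end

section \<open>Rooted subtrees of backward orbits\<close>

context backward_system
begin

text \<open>
  The shape of the orbit of a point under a tree of words: all that matters about it is that moving
  towards the root \<open>x\<close> does not leave \<open>S\<close> and that \<open>h\<close> steps suffice.
\<close>
definition rooted :: "nat \<Rightarrow> 'a \<Rightarrow> 'a set \<Rightarrow> bool" where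
  "rooted h x S \<longleftrightarrow> x \<in> S \<and> S \<subseteq> (\<Union>k\<le>h. preimages k x) \<and> (\<forall>y\<in>S - {x}. T y \<in> S)"

lemma word_orbit_rooted:
  assumes \<tau>: "\<tau> \<in> trees \<Gamma>" and x: "x \<in> space M"
  shows "rooted (height \<tau>) x (word_orbit \<tau> x)"
  unfolding rooted_def
proof (intro conjI ballI subsetI)
  have len: "length t \<le> height \<tau>" if "t \<in> \<tau>" for t
  proof -
    have "\<forall>t\<in>\<tau>. length t \<le> height \<tau>"
      unfolding height_def by (rule LeastI_ex) (use \<tau> in \<open>simp add: trees_def\<close>)
    with that show ?thesis by auto
  qed
  have sub: "\<tau> \<subseteq> lists \<Gamma>" and nil: "[] \<in> \<tau>"
    and closed_all: "\<forall>s t. s @ t \<in> \<tau> \<longrightarrow> t \<in> \<tau>"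
    using \<tau> unfolding trees_def by simp_all
  have closed: "t \<in> \<tau>" if "s @ t \<in> \<tau>" for s t using closed_all that by blast
  show "x \<in> word_orbit \<tau> x" using nil by (auto simp: word_orbit_def intro!: bexI[of _ "[]"])
  show "y \<in> (\<Union>k\<le>height \<tau>. preimages k x)" if y: "y \<in> word_orbit \<tau> x" for y
  proof -
    obtain t where t: "t \<in> \<tau>" "word_map t x = Some y" using y by (auto simp: word_orbit_def)
    then have "y \<in> preimages (length t) x" using word_map_preimage sub x by blast
    with len[OF t(1)] show ?thesis by auto
  qed
  show "T y \<in> word_orbit \<tau> x" if y: "y \<in> word_orbit \<tau> x - {x}" for y
  proof -
    obtain t where t: "t \<in> \<tau>" "word_map t x = Some y" using y by (auto simp: word_orbit_def)
    then obtain \<gamma> s where \<gamma>s: "t = \<gamma> # s" using y by (cases t) auto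
    then obtain z where z: "word_map s x = Some z" "\<gamma> z = Some y"
      using t by (auto simp: map_comp_Some_iff)
    have "\<gamma> \<in> \<Gamma>" using t(1) sub \<gamma>s by auto
    from inverse_graph(3)[OF this z(2)] have "T y = z" .
    moreover have "s \<in> \<tau>" using closed[of "[\<gamma>]" s] t(1) \<gamma>s by simp
    ultimately show ?thesis using z by (auto simp: word_orbit_def)
  qed
qed

lemma wsum_rooted_le:
  assumes x: "x \<in> space M" and S: "rooted h x S"
  shows "wsum x S f \<le> (\<Sum>k\<le>h. (transfer ^^ k) f x)"
proof -
  let ?F = "\<lambda>y. ennreal (\<rho> x y) * f y"
  have "wsum x S f = (\<integral>\<^sup>+y. ?F y * indicator S y \<partial>count_space UNIV)"
    by (simp add: wsum_def nn_integral_count_space_indicator)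
  also have "\<dots> \<le> (\<integral>\<^sup>+y. (\<Sum>k\<le>h. ?F y * indicator (preimages k x) y) \<partial>count_space UNIV)"
    (is "_ \<le> ?R")
  proof (rule nn_integral_mono)
    fix y
    show "?F y * indicator S y \<le> (\<Sum>k\<le>h. ?F y * indicator (preimages k x) y)"
    proof (cases "y \<in> S")
      case True
      with S obtain j where "j \<le> h" "y \<in> preimages j x" by (auto simp: rooted_def)
      then have "?F y * indicator S y \<le> ?F y * indicator (preimages j x) y" by (simp add: indicator_def)
      also have "\<dots> \<le> (\<Sum>k\<le>h. ?F y * indicator (preimages k x) y)"
        using \<open>j \<le> h\<close> by (intro member_le_sum) auto
      finally show ?thesis .
    qed simp
  qed
  also have "?R = (\<Sum>k\<le>h. \<integral>\<^sup>+y. ?F y * indicator (preimages k x) y \<partial>count_space UNIV)"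
    by (rule nn_integral_sum) simp
  also have "\<dots> = (\<Sum>k\<le>h. wsum x (preimages k x) f)"
    by (intro sum.cong refl) (simp add: wsum_def nn_integral_count_space_indicator)
  also have "\<dots> = (\<Sum>k\<le>h. (transfer ^^ k) f x)"
    by (simp add: transfer_power_eq_wsum[OF x])
  finally show ?thesis .
qed

text \<open>
  Grouping the vertices \<open>y \<noteq> x\<close> by their parents \<open>z = T y \<in> S\<close>, the children of \<open>z\<close> have total weight
  at most \<open>\<rho>\<^sub>x(z) \<cdot> transfer 1 z\<close>, hence at most the weight of \<open>z\<close> itself.
\<close>
lemma wsum_shift_le:
  assumes x: "x \<in> space M" and S: "rooted h x S"
    and sub: "\<And>z. z \<in> S \<Longrightarrow> transfer (\<lambda>_. 1) z \<le> 1"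
  shows "wsum x (S - {x}) (\<lambda>y. g (T y)) \<le> wsum x S g"
proof -
  let ?F = "\<lambda>y. ennreal (\<rho> x y) * g (T y)"
  have "S - {x} = {y\<in>S - {x}. T y \<in> S}" using S by (auto simp: rooted_def)
  then have "wsum x (S - {x}) (\<lambda>y. g (T y))
      = (\<integral>\<^sup>+y. ?F y \<partial>count_space {y\<in>S - {x}. T y \<in> S})"
    by (simp add: wsum_def)
  also have "\<dots> = (\<integral>\<^sup>+z. (\<integral>\<^sup>+y. ?F y \<partial>count_space {y\<in>S - {x}. T y = z}) \<partial>count_space S)"
    by (rule nn_integral_count_space_fibres[symmetric])
  also have "\<dots> \<le> (\<integral>\<^sup>+z. ennreal (\<rho> x z) * g z \<partial>count_space S)"
  proof (rule nn_integral_mono)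
    fix z assume "z \<in> space (count_space S)"
    then have zS: "z \<in> S" by simp
    then obtain k where z: "z \<in> preimages k x" using S by (auto simp: rooted_def)
    have "S \<subseteq> space M" using S by (auto simp: rooted_def preimages_def)
    then have "(\<integral>\<^sup>+y. ?F y \<partial>count_space {y\<in>S - {x}. T y = z})
        \<le> (\<integral>\<^sup>+y. ?F y \<partial>count_space (preimages 1 z))"
      by (intro nn_integral_count_space_mono_set) (auto simp: preimages_def)
    also have "\<dots> = (\<integral>\<^sup>+y. (ennreal (\<rho> x z) * g z) * (ennreal (\<rho> z y) * 1) \<partial>count_space (preimages 1 z))"
    proof (rule nn_integral_cong)
      fix y assume "y \<in> space (count_space (preimages 1 z))"
      then have y: "y \<in> preimages 1 z" by simp
      then have "T y = z" by (simp add: preimages_def)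
      then show "?F y = (ennreal (\<rho> x z) * g z) * (ennreal (\<rho> z y) * 1)"
        using rho_cocycle_preimages[OF x z y] by (simp add: ac_simps)
    qed
    also have "\<dots> = (ennreal (\<rho> x z) * g z) * transfer (\<lambda>_. 1) z"
      unfolding transfer_def wsum_def by (rule nn_integral_cmult) simp
    also have "\<dots> \<le> (ennreal (\<rho> x z) * g z) * 1"
      by (intro mult_left_mono sub zS) simp
    finally show "(\<integral>\<^sup>+y. ?F y \<partial>count_space {y\<in>S - {x}. T y = z}) \<le> ennreal (\<rho> x z) * g z"
      by simp
  qed
  finally show ?thesis by (simp add: wsum_def)
qed

text \<open>
  The real counterpart of \<open>wsum\<close>; the Bochner integral makes it \<open>0\<close> if the sum does not converge
  absolutely.
\<close>
definition rsum :: "'a \<Rightarrow> 'a set \<Rightarrow> ('a \<Rightarrow> real) \<Rightarrow> real" where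
  "rsum x S f = (LINT y|count_space S. f y * \<rho> x y)"

lemma rooted_pos:
  assumes "x \<in> space M" "rooted h x S" "y \<in> S"
  shows "0 < \<rho> x y"
  using assms rho_pos[OF preimages_orbit[OF assms(1)]] by (auto simp: rooted_def)

lemma integrable_rsum_iff:
  assumes "x \<in> space M" "rooted h x S"
  shows "integrable (count_space S) (\<lambda>y. f y * \<rho> x y) \<longleftrightarrow> wsum x S (\<lambda>y. ennreal \<bar>f y\<bar>) < \<infinity>"
proof -
  have "(\<integral>\<^sup>+y. ennreal (norm (f y * \<rho> x y)) \<partial>count_space S) = wsum x S (\<lambda>y. ennreal \<bar>f y\<bar>)"
    unfolding wsum_def using rooted_pos[OF assms]
    by (intro nn_integral_cong) (simp add: abs_mult ennreal_mult[symmetric] less_imp_le mult.commute)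
  then show ?thesis by (simp add: integrable_iff_bounded)
qed

lemma wsum_eq_rsum:
  assumes "x \<in> space M" "rooted h x S" "\<And>y. y \<in> S \<Longrightarrow> 0 \<le> f y" "wsum x S (\<lambda>y. ennreal (f y)) < \<infinity>"
  shows "wsum x S (\<lambda>y. ennreal (f y)) = ennreal (rsum x S f)"
proof -
  have "wsum x S (\<lambda>y. ennreal \<bar>f y\<bar>) = wsum x S (\<lambda>y. ennreal (f y))"
    unfolding wsum_def using assms(3) by (intro nn_integral_cong) simp
  then have int: "integrable (count_space S) (\<lambda>y. f y * \<rho> x y)"
    using assms(4) by (simp add: integrable_rsum_iff[OF assms(1,2)])
  have "wsum x S (\<lambda>y. ennreal (f y)) = (\<integral>\<^sup>+y. ennreal (f y * \<rho> x y) \<partial>count_space S)"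
    unfolding wsum_def using rooted_pos[OF assms(1,2)] assms(3)
    by (intro nn_integral_cong) (simp add: ennreal_mult[symmetric] less_imp_le mult.commute)
  also have "\<dots> = ennreal (rsum x S f)"
    unfolding rsum_def using rooted_pos[OF assms(1,2)] assms(3)
    by (intro nn_integral_eq_integral int) (auto simp: AE_count_space less_imp_le)
  finally show ?thesis .
qed

lemma rsum_nonneg:
  assumes "x \<in> space M" "rooted h x S" "\<And>y. y \<in> S \<Longrightarrow> 0 \<le> f y"
  shows "0 \<le> rsum x S f"
  unfolding rsum_def using rooted_pos[OF assms(1,2)] assms(3)
  by (intro Bochner_Integration.integral_nonneg) (auto simp: less_imp_le)

lemma rsum_abs_le:
  assumes "x \<in> space M" "rooted h x S"
  shows "\<bar>rsum x S f\<bar> \<le> rsum x S (\<lambda>y. \<bar>f y\<bar>)"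
proof -
  have "\<bar>rsum x S f\<bar> \<le> (LINT y|count_space S. norm (f y * \<rho> x y))"
    unfolding rsum_def using integral_norm_bound by (metis real_norm_def)
  also have "\<dots> = rsum x S (\<lambda>y. \<bar>f y\<bar>)"
    unfolding rsum_def using rooted_pos[OF assms]
    by (intro Bochner_Integration.integral_cong) (auto simp: abs_mult less_imp_le)
  finally show ?thesis .
qed

lemma word_orbit_weight:
  assumes "J \<subseteq> lists \<Gamma>"
  shows "weight \<rho> x (word_orbit J x) = wsum x (word_orbit J x) (\<lambda>_. 1)"
  unfolding weight_def wsum_def
  by (simp add: infsum_ennreal_conv_nn_integral[OF countable_word_orbit[OF assms]])

lemma tree_words: "\<tau> \<in> trees \<Gamma> \<Longrightarrow> \<tau> \<subseteq> lists \<Gamma>"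
  by (simp add: trees_def)

lemma word_average_eq:
  assumes "J \<subseteq> lists \<Gamma>"
  shows "word_average \<rho> J f x
    = rsum x (word_orbit J x) f / enn2real (wsum x (word_orbit J x) (\<lambda>_. 1))"
  unfolding word_average_def rsum_def
  by (simp add: word_orbit_weight[OF assms] infsum_real_conv_integral)

lemma word_average_measurable:
  assumes \<tau>: "\<tau> \<in> trees \<Gamma>" and [measurable]: "f \<in> borel_measurable M"
  shows "word_average \<rho> \<tau> f \<in> borel_measurable M"
proof -
  note words = tree_words[OF \<tau>]
  let ?S = "word_orbit \<tau>"
  let ?R = "\<lambda>x. if wsum x (?S x) (\<lambda>y. ennreal \<bar>f y\<bar>) < \<infinity>
      then enn2real (wsum x (?S x) (\<lambda>y. ennreal (f y))) - enn2real (wsum x (?S x) (\<lambda>y. ennreal (- f y)))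
      else 0"
  note [measurable] = wsum_word_orbit_measurable[OF words]
  have "(\<lambda>x. ?R x / enn2real (wsum x (?S x) (\<lambda>_. 1))) \<in> borel_measurable M"
    by measurable
  also have "?this \<longleftrightarrow> ?thesis"
  proof (rule measurable_cong)
    fix x assume x: "x \<in> space M"
    note S = word_orbit_rooted[OF \<tau> x]
    have pm: "wsum x (?S x) (\<lambda>y. ennreal (s * f y)) = (\<integral>\<^sup>+y. ennreal (s * (f y * \<rho> x y)) \<partial>count_space (?S x))" for s
      unfolding wsum_def
    proof (rule nn_integral_cong)
      fix y assume "y \<in> space (count_space (?S x))"
      then have "0 \<le> \<rho> x y" using rooted_pos[OF x S, of y] by simp
      from ennreal_mult''[OF this, of "s * f y"]
      show "ennreal (\<rho> x y) * ennreal (s * f y) = ennreal (s * (f y * \<rho> x y))"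
        by (simp add: mult.assoc mult.commute[of "ennreal (\<rho> x y)"])
    qed
    have "rsum x (?S x) f = ?R x"
    proof (cases "integrable (count_space (?S x)) (\<lambda>y. f y * \<rho> x y)")
      case True
      then have "wsum x (?S x) (\<lambda>y. ennreal \<bar>f y\<bar>) < \<infinity>"
        by (simp only: integrable_rsum_iff[OF x S])
      then show ?thesis using True pm[of 1] pm[of "-1"]
        by (simp add: rsum_def real_lebesgue_integral_def)
    next
      case False
      then have "\<not> wsum x (?S x) (\<lambda>y. ennreal \<bar>f y\<bar>) < \<infinity>"
        unfolding integrable_rsum_iff[OF x S] .
      then show ?thesis using False by (simp add: rsum_def not_integrable_integral_eq)
    qed
    then show "?R x / enn2real (wsum x (?S x) (\<lambda>_. 1)) = word_average \<rho> \<tau> f x"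
      by (simp add: word_average_eq[OF words])
  qed
  finally show ?thesis .
qed

text \<open>
  The vertex \<open>x\<close> has weight \<open>1\<close> and contributes at most \<open>D\<close>; the other vertices are covered by the
  comparison of children with parents.
\<close>
lemma rsum_shift_le:
  assumes x: "x \<in> space M" and S: "rooted h x S"
    and sub: "\<And>z. z \<in> S \<Longrightarrow> transfer (\<lambda>_. 1) z \<le> 1"
    and fin: "wsum x S (\<lambda>_. 1) < \<infinity>"
    and g: "\<And>y. 0 \<le> g y" "\<And>y. g y \<le> D"
  shows "rsum x S (\<lambda>y. g (T y)) \<le> rsum x S g + D"
proof -
  have "0 \<le> D" using g[of x] by linarith
  have bdd: "wsum x S (\<lambda>y. ennreal (u y)) < \<infinity>" if "\<And>y. u y \<le> D" for u
  proof -
    have "wsum x S (\<lambda>y. ennreal (u y)) \<le> (\<integral>\<^sup>+y. ennreal D * (ennreal (\<rho> x y) * 1) \<partial>count_space S)"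
      unfolding wsum_def using that
      by (intro nn_integral_mono) (auto simp: mult.commute[of "ennreal (\<rho> x _)"] intro!: mult_right_mono ennreal_leI)
    also have "\<dots> = ennreal D * wsum x S (\<lambda>_. 1)"
      unfolding wsum_def by (rule nn_integral_cmult) simp
    also have "\<dots> < \<infinity>" using fin by (simp add: ennreal_mult_less_top)
    finally show ?thesis .
  qed
  have xS: "x \<in> S" using S by (simp add: rooted_def)
  have "wsum x S (\<lambda>y. ennreal (g (T y)))
      = wsum x {x} (\<lambda>y. ennreal (g (T y))) + wsum x (S - {x}) (\<lambda>y. ennreal (g (T y)))"
  proof -
    have "wsum x S (\<lambda>y. ennreal (g (T y)))
      = (\<integral>\<^sup>+y. ennreal (\<rho> x y) * ennreal (g (T y)) * indicator {x} y
          + ennreal (\<rho> x y) * ennreal (g (T y)) * indicator (S - {x}) y \<partial>count_space S)"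
      unfolding wsum_def by (intro nn_integral_cong) (auto simp: indicator_def)
    also have "\<dots> = (\<integral>\<^sup>+y. ennreal (\<rho> x y) * ennreal (g (T y)) * indicator {x} y \<partial>count_space S)
        + (\<integral>\<^sup>+y. ennreal (\<rho> x y) * ennreal (g (T y)) * indicator (S - {x}) y \<partial>count_space S)"
      by (rule nn_integral_add) simp_all
    also have "(\<integral>\<^sup>+y. ennreal (\<rho> x y) * ennreal (g (T y)) * indicator {x} y \<partial>count_space S)
        = wsum x {x} (\<lambda>y. ennreal (g (T y)))"
      unfolding wsum_def using xS by (intro nn_integral_count_space_subset) simp
    also have "(\<integral>\<^sup>+y. ennreal (\<rho> x y) * ennreal (g (T y)) * indicator (S - {x}) y \<partial>count_space S)
        = wsum x (S - {x}) (\<lambda>y. ennreal (g (T y)))"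
      unfolding wsum_def by (intro nn_integral_count_space_subset) auto
    finally show ?thesis .
  qed
  also have "\<dots> \<le> ennreal D + wsum x S (\<lambda>y. ennreal (g y))"
  proof (rule add_mono)
    show "wsum x {x} (\<lambda>y. ennreal (g (T y))) \<le> ennreal D"
      using g(2) by (simp add: wsum_def nn_integral_count_space_finite rho_refl[OF x] ennreal_leI)
    show "wsum x (S - {x}) (\<lambda>y. ennreal (g (T y))) \<le> wsum x S (\<lambda>y. ennreal (g y))"
      by (rule wsum_shift_le[OF x S sub])
  qed
  also have "wsum x S (\<lambda>y. ennreal (g (T y))) = ennreal (rsum x S (\<lambda>y. g (T y)))"
    using g by (intro wsum_eq_rsum[OF x S] bdd) auto
  also have "wsum x S (\<lambda>y. ennreal (g y)) = ennreal (rsum x S g)"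
    using g by (intro wsum_eq_rsum[OF x S] bdd) auto
  finally show ?thesis
    using rsum_nonneg[OF x S, of g] g \<open>0 \<le> D\<close>
    by (simp add: ennreal_plus[symmetric] add.commute del: ennreal_plus)
qed

text \<open>
  The one-sided comparison for \<open>g + C\<close> and for \<open>C - g\<close>. The bound depends neither on the tree
  nor on its weight.
\<close>
lemma rsum_coboundary_bound:
  assumes x: "x \<in> space M" and S: "rooted h x S"
    and sub: "\<And>z. z \<in> S \<Longrightarrow> transfer (\<lambda>_. 1) z \<le> 1"
    and fin: "wsum x S (\<lambda>_. 1) < \<infinity>"
    and g: "\<And>y. \<bar>g y\<bar> \<le> C"
  shows "\<bar>rsum x S g - rsum x S (\<lambda>y. g (T y))\<bar> \<le> 2 * C"
proof -
  let ?I = "\<lambda>f. integrable (count_space S) (\<lambda>y. f y * \<rho> x y)"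
  have one: "?I (\<lambda>_. 1)" using fin by (simp only: integrable_rsum_iff[OF x S]) simp
  have int: "?I u" if "\<And>y. \<bar>u y\<bar> \<le> C" for u
  proof (rule Bochner_Integration.integrable_bound)
    show "integrable (count_space S) (\<lambda>y. C * (1 * \<rho> x y))" by (rule integrable_mult_right) (use one in simp)
    show "AE y in count_space S. norm (u y * \<rho> x y) \<le> norm (C * (1 * \<rho> x y))"
      using that rooted_pos[OF x S] by (auto simp: AE_count_space abs_mult intro!: mult_right_mono order_trans[OF that])
  qed simp
  have gC: "- C \<le> g y" "g y \<le> C" for y using g[of y] by auto
  have lin: "rsum x S (\<lambda>y. u y + C) = rsum x S u + C * rsum x S (\<lambda>_. 1)"
    "rsum x S (\<lambda>y. C - u y) = C * rsum x S (\<lambda>_. 1) - rsum x S u" if u: "\<And>y. \<bar>u y\<bar> \<le> C" for u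
    unfolding rsum_def distrib_right left_diff_distrib
    using int[of u, OF u] int[of "\<lambda>_. C"] one g[of x] by simp_all
  have "rsum x S (\<lambda>y. g (T y) + C) \<le> rsum x S (\<lambda>y. g y + C) + 2 * C"
    by (rule rsum_shift_le[OF x S sub fin, where g = "\<lambda>y. g y + C"]) (smt (verit) gC)+
  moreover have "rsum x S (\<lambda>y. C - g (T y)) \<le> rsum x S (\<lambda>y. C - g y) + 2 * C"
    by (rule rsum_shift_le[OF x S sub fin, where g = "\<lambda>y. C - g y"]) (smt (verit) gC)+
  ultimately show ?thesis using lin[of g] lin[of "\<lambda>y. g (T y)"] g by simp
qed

end

section \<open>Averages over fat trees: almost everywhere convergence\<close>

context backward_system
begin

text \<open>
  The transfer operator fixes constants almost everywhere, so they can serve as thresholds in the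
  maximal inequality.
\<close>
lemma transfer_maximal_inequality:
  assumes [measurable]: "r \<in> borel_measurable M" and fin: "(\<integral>\<^sup>+x. r x \<partial>M) < \<infinity>"
  shows "ennreal a * emeasure M {x\<in>space M. \<exists>n. of_nat n * ennreal a < (\<Sum>k<n. (transfer ^^ k) r x)}
    \<le> (\<integral>\<^sup>+x. r x \<partial>M)"
proof -
  let ?A = "{x\<in>space M. \<exists>n. of_nat n * ennreal a < (\<Sum>k<n. (transfer ^^ k) r x)}"
  have [measurable]: "?A \<in> sets M" by measurable
  have mult: "transfer (\<lambda>x. C * g x) = (\<lambda>x. C * transfer g x)" for C g
    unfolding transfer_def wsum_def
    by (simp add: nn_integral_cmult[symmetric] mult.left_commute fun_eq_iff)
  have "(\<integral>\<^sup>+x\<in>?A. ennreal a \<partial>M) \<le> (\<integral>\<^sup>+x\<in>?A. r x \<partial>M)"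
  proof (rule hopf_maximal_inequality)
    show "transfer f \<le> transfer g" if "f \<le> g" for f g
      using that by (auto simp: le_fun_def transfer_def wsum_def intro!: nn_integral_mono mult_left_mono)
    show "transfer (\<lambda>x. f x + g x) = (\<lambda>x. transfer f x + transfer g x)" for f g
      by (rule ext) (simp add: transfer_def wsum_def distrib_left nn_integral_add)
    show "AE x in M. transfer (\<lambda>_. ennreal a) x \<le> ennreal a"
      using transfer_one by eventually_elim (use mult[of "ennreal a" "\<lambda>_. 1"] in simp)
  qed (use fin in \<open>simp_all add: mult nn_integral_transfer\<close>)
  also have "\<dots> \<le> (\<integral>\<^sup>+x. r x \<partial>M)" by (intro nn_integral_mono) (auto simp: indicator_def)
  finally show ?thesis by (simp add: nn_integral_cmult_indicator)
qed

end

locale fat_tree_sequence = backward_system M T \<rho> \<Gamma>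
  for M :: "'a measure" and T \<rho> \<Gamma> +
  fixes c :: real and \<tau> :: "nat \<Rightarrow> ('a \<rightharpoonup> 'a) list set"
  assumes c_pos: "c > 0"
    and trees: "\<And>n. \<tau> n \<in> trees \<Gamma>"
    and fat_trees: "\<And>n. fat M \<rho> c (\<tau> n)"
    and heights: "filterlim (\<lambda>n. height (\<tau> n)) at_top sequentially"
begin

abbreviation (input) "avg n \<equiv> word_average \<rho> (\<tau> n)"
abbreviation (input) "S n x \<equiv> word_orbit (\<tau> n) x"
abbreviation (input) "W n x \<equiv> rsum x (S n x) (\<lambda>_. 1)"

text \<open>
  The points at which all almost-everywhere properties used below hold: \<open>transfer 1 \<le> 1\<close> along the
  backward orbit, finiteness of all tree weights, and fatness of all trees.
\<close>
definition regular :: "'a \<Rightarrow> bool" where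
  "regular x \<longleftrightarrow> x \<in> space M \<and> (\<forall>k. \<forall>y\<in>preimages k x. transfer (\<lambda>_. 1) y \<le> 1) \<and>
     (\<forall>k. (transfer ^^ k) (\<lambda>_. 1) x < \<infinity>) \<and>
     (\<forall>n. ennreal c \<le> weight \<rho> x (S n x) / of_nat (height (\<tau> n) + 1))"

text \<open>
  Finiteness on every generation of preimages makes the sums over all trees converge
  absolutely, because trees have bounded height.
\<close>
definition summable_at :: "('a \<Rightarrow> real) \<Rightarrow> 'a \<Rightarrow> bool" where
  "summable_at f x \<longleftrightarrow> (\<forall>k. (transfer ^^ k) (\<lambda>y. ennreal \<bar>f y\<bar>) x < \<infinity>)"

lemma AE_transfer_pow_finite:
  assumes [measurable]: "f \<in> borel_measurable M" and "(\<integral>\<^sup>+x. f x \<partial>M) < \<infinity>"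
  shows "AE x in M. \<forall>k. (transfer ^^ k) f x < \<infinity>"
  unfolding AE_all_countable
proof
  fix k
  have "AE x in M. (transfer ^^ k) f x \<noteq> \<infinity>"
    by (rule nn_integral_noteq_infinite) (use assms(2) in \<open>simp_all add: nn_integral_transfer_pow\<close>)
  then show "AE x in M. (transfer ^^ k) f x < \<infinity>" by eventually_elim (simp add: less_top)
qed

lemma AE_regular: "AE x in M. regular x"
proof -
  have "AE x in M. \<forall>k. \<forall>y\<in>preimages k x. transfer (\<lambda>_. 1) y \<le> 1"
    by (rule AE_backward_orbit) (use transfer_one in \<open>eventually_elim, simp\<close>)
  moreover have "AE x in M. \<forall>k. (transfer ^^ k) (\<lambda>_. 1) x < \<infinity>"
    by (rule AE_transfer_pow_finite) (simp_all add: emeasure_space_1)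
  moreover have "AE x in M. \<forall>n. ennreal c \<le> weight \<rho> x (S n x) / of_nat (height (\<tau> n) + 1)"
    unfolding AE_all_countable using fat_trees by (simp add: fat_def)
  ultimately show ?thesis using AE_space by eventually_elim (simp add: regular_def)
qed

lemma AE_summable_at:
  assumes "integrable M f"
  shows "AE x in M. summable_at f x"
  unfolding summable_at_def
  using assms by (intro AE_transfer_pow_finite) (auto simp: integrable_iff_bounded)

lemma rooted_tree: "x \<in> space M \<Longrightarrow> rooted (height (\<tau> n)) x (S n x)"
  by (rule word_orbit_rooted[OF trees])

lemma wsum_tree_finite:
  assumes "x \<in> space M" "summable_at f x"
  shows "wsum x (S n x) (\<lambda>y. ennreal \<bar>f y\<bar>) < \<infinity>"
proof -
  have "(\<Sum>k\<le>height (\<tau> n). (transfer ^^ k) (\<lambda>y. ennreal \<bar>f y\<bar>) x) < \<infinity>"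
    using assms(2) by (simp add: summable_at_def ennreal_sum_less_top)
  with wsum_rooted_le[OF assms(1) rooted_tree[OF assms(1)]] show ?thesis
    by (rule le_less_trans)
qed

lemma integrable_tree:
  assumes "x \<in> space M" "summable_at f x"
  shows "integrable (count_space (S n x)) (\<lambda>y. f y * \<rho> x y)"
  using wsum_tree_finite[OF assms] by (simp only: integrable_rsum_iff[OF assms(1) rooted_tree[OF assms(1)]])

lemma regularD:
  assumes "regular x"
  shows "x \<in> space M" "summable_at (\<lambda>_. C) x"
proof -
  show "x \<in> space M" using assms by (simp add: regular_def)
  have const: "(transfer ^^ k) (\<lambda>_. a) y = a * (transfer ^^ k) (\<lambda>_. 1) y" if "y \<in> space M" for k a y
    unfolding transfer_power_eq_wsum[OF that] wsum_def
    by (simp add: nn_integral_cmult[symmetric] mult.commute)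
  show "summable_at (\<lambda>_. C) x"
    using assms unfolding summable_at_def regular_def
    by (subst const) (simp_all add: ennreal_mult_less_top)
qed

lemma tree_weight:
  assumes "regular x"
  shows "c * (real (height (\<tau> n)) + 1) \<le> W n x" "0 < W n x"
    "wsum x (S n x) (\<lambda>_. 1) = ennreal (W n x)"
proof -
  note x = regularD[OF assms]
  note root = rooted_tree[OF x(1), of n]
  have fin: "wsum x (S n x) (\<lambda>_. 1) < \<infinity>"
    using wsum_tree_finite[OF x(1) x(2)[of 1]] by simp
  show eq: "wsum x (S n x) (\<lambda>_. 1) = ennreal (W n x)"
    using wsum_eq_rsum[OF x(1) root, of "\<lambda>_. 1"] fin by simp
  have "ennreal c \<le> ennreal (W n x) / of_nat (height (\<tau> n) + 1)"
  proof -
    have "ennreal c \<le> weight \<rho> x (S n x) / of_nat (height (\<tau> n) + 1)"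
      using assms by (simp add: regular_def)
    then show ?thesis unfolding word_orbit_weight[OF tree_words[OF trees]] eq .
  qed
  also have "\<dots> = ennreal (W n x / real (height (\<tau> n) + 1))"
    using rsum_nonneg[OF x(1) root, of "\<lambda>_. 1"]
    by (simp add: ennreal_of_nat_eq_real_of_nat divide_ennreal del: of_nat_add of_nat_Suc)
  finally have "c \<le> W n x / real (height (\<tau> n) + 1)"
    using rsum_nonneg[OF x(1) root, of "\<lambda>_. 1"] by (simp add: ennreal_le_iff)
  then show le: "c * (real (height (\<tau> n)) + 1) \<le> W n x"
    by (simp add: pos_le_divide_eq add.commute)
  have "0 < c * (real (height (\<tau> n)) + 1)" using c_pos by simp
  with le show "0 < W n x" by linarith
qed

lemma avg_eq:
  assumes "regular x"
  shows "avg n f x = rsum x (S n x) f / W n x"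
  using tree_weight[OF assms, of n] by (simp add: word_average_eq[OF tree_words[OF trees]])

lemma avg_add:
  assumes "regular x" "summable_at f x" "summable_at g x"
  shows "avg n (\<lambda>y. f y + g y) x = avg n f x + avg n g x"
  using integrable_tree[OF _ assms(2)] integrable_tree[OF _ assms(3)] regularD[OF assms(1)]
  by (simp add: avg_eq[OF assms(1)] rsum_def distrib_right add_divide_distrib)

lemma avg_abs_le:
  assumes "regular x"
  shows "\<bar>avg n f x\<bar> \<le> avg n (\<lambda>y. \<bar>f y\<bar>) x"
  using rsum_abs_le[OF regularD(1)[OF assms] rooted_tree[OF regularD(1)[OF assms]], of n f] tree_weight[OF assms, of n]
  by (simp add: avg_eq[OF assms] divide_right_mono)

lemma avg_mono:
  assumes "regular x" "summable_at f x" "summable_at g x" "\<And>y. f y \<le> g y"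
  shows "avg n f x \<le> avg n g x"
proof -
  note x = regularD(1)[OF assms(1)]
  have "rsum x (S n x) f \<le> rsum x (S n x) g"
    unfolding rsum_def
    using rooted_pos[OF x rooted_tree[OF x]] assms(4)
    by (intro integral_mono_AE integrable_tree x assms)
       (auto simp: AE_count_space intro!: mult_right_mono less_imp_le)
  then show ?thesis using tree_weight(2)[OF assms(1), of n] by (simp add: avg_eq[OF assms(1)] divide_right_mono)
qed

lemma avg_const:
  assumes "regular x"
  shows "avg n (\<lambda>_. C) x = C"
  using tree_weight(2)[OF assms, of n] by (simp add: avg_eq[OF assms] rsum_def)

lemma avg_cong:
  assumes "\<And>y. y \<in> S n x \<Longrightarrow> f y = g y"
  shows "avg n f x = avg n g x"
proof -
  have "rsum x (S n x) f = rsum x (S n x) g"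
    unfolding rsum_def using assms by (intro Bochner_Integration.integral_cong) auto
  then show ?thesis by (simp add: word_average_eq[OF tree_words[OF trees]])
qed

lemma avg_invariant:
  assumes x: "regular x" and g: "\<And>y. y \<in> space M \<Longrightarrow> g (T y) = g y"
  shows "avg n g x = g x" "summable_at g x"
proof -
  have pow: "g ((T ^^ k) y) = g y" if "y \<in> space M" for k y
    using that by (induction k) (simp_all add: g)
  then have pre: "g y = g x" if "y \<in> preimages k x" for k y
    using that by (auto simp: preimages_def)
  have "avg n g x = avg n (\<lambda>_. g x) x"
    using rooted_tree[OF regularD(1)[OF x], of n] pre by (intro avg_cong) (auto simp: rooted_def)
  then show "avg n g x = g x" by (simp add: avg_const[OF x])
  have "(transfer ^^ k) (\<lambda>y. ennreal \<bar>g y\<bar>) x = (transfer ^^ k) (\<lambda>_. ennreal \<bar>g x\<bar>) x" for k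
    unfolding transfer_power_eq_wsum[OF regularD(1)[OF x]] wsum_def
    by (intro nn_integral_cong) (simp add: pre)
  with regularD(2)[OF x, of "g x"] show "summable_at g x" by (simp add: summable_at_def)
qed

lemma summable_at_mono:
  assumes "summable_at g x" "\<And>y. \<bar>f y\<bar> \<le> \<bar>g y\<bar>" "x \<in> space M"
  shows "summable_at f x"
  unfolding summable_at_def
proof
  fix k
  have "(transfer ^^ k) (\<lambda>y. ennreal \<bar>f y\<bar>) x \<le> (transfer ^^ k) (\<lambda>y. ennreal \<bar>g y\<bar>) x"
    unfolding transfer_power_eq_wsum[OF assms(3)] wsum_def
    by (intro nn_integral_mono mult_left_mono ennreal_leI assms) simp
  also have "\<dots> < \<infinity>" using assms(1) by (simp add: summable_at_def)
  finally show "(transfer ^^ k) (\<lambda>y. ennreal \<bar>f y\<bar>) x < \<infinity>" .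
qed

lemma summable_at_add:
  assumes "x \<in> space M" "summable_at f x" "summable_at g x"
  shows "summable_at (\<lambda>y. f y + g y) x"
  unfolding summable_at_def
proof
  fix k
  have "(transfer ^^ k) (\<lambda>y. ennreal \<bar>f y + g y\<bar>) x
      \<le> wsum x (preimages k x) (\<lambda>y. ennreal \<bar>f y\<bar> + ennreal \<bar>g y\<bar>)"
    unfolding transfer_power_eq_wsum[OF assms(1)] wsum_def
    by (intro nn_integral_mono mult_left_mono)
       (simp_all add: ennreal_plus[symmetric] ennreal_leI del: ennreal_plus)
  also have "\<dots> = (transfer ^^ k) (\<lambda>y. ennreal \<bar>f y\<bar>) x + (transfer ^^ k) (\<lambda>y. ennreal \<bar>g y\<bar>) x"
    unfolding transfer_power_eq_wsum[OF assms(1)] wsum_def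
    by (simp add: distrib_left nn_integral_add)
  also have "\<dots> < \<infinity>" using assms(2,3) by (simp add: summable_at_def)
  finally show "(transfer ^^ k) (\<lambda>y. ennreal \<bar>f y + g y\<bar>) x < \<infinity>" .
qed

lemma summable_at_bounded:
  assumes "regular x" "\<And>y. \<bar>f y\<bar> \<le> C"
  shows "summable_at f x"
  by (rule summable_at_mono[OF regularD(2)[OF assms(1), of C]])
    (use assms(2) regularD(1)[OF assms(1)] in \<open>auto intro: order_trans[OF _ abs_ge_self]\<close>)

text \<open>
  Fatness enters here: dividing by the weight of the tree costs only the factor \<open>1 / c\<close> compared with
  dividing by the number of generations.
\<close>
lemma avg_abs_le_transfer:
  assumes x: "regular x" and f: "summable_at f x"
  shows "ennreal (c * (real (height (\<tau> n)) + 1)) * ennreal (avg n (\<lambda>y. \<bar>f y\<bar>) x)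
    \<le> (\<Sum>k<Suc (height (\<tau> n)). (transfer ^^ k) (\<lambda>y. ennreal \<bar>f y\<bar>) x)"
proof -
  note M = regularD(1)[OF x]
  note root = rooted_tree[OF M, of n]
  have nonneg: "0 \<le> rsum x (S n x) (\<lambda>y. \<bar>f y\<bar>)" by (rule rsum_nonneg[OF M root]) simp
  have "ennreal (c * (real (height (\<tau> n)) + 1)) * ennreal (avg n (\<lambda>y. \<bar>f y\<bar>) x)
      \<le> ennreal (W n x) * ennreal (avg n (\<lambda>y. \<bar>f y\<bar>) x)"
    by (intro mult_right_mono ennreal_leI tree_weight[OF x]) simp
  also have "\<dots> = ennreal (rsum x (S n x) (\<lambda>y. \<bar>f y\<bar>))"
    using tree_weight(2)[OF x, of n] nonneg by (simp add: avg_eq[OF x] ennreal_mult[symmetric])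
  also have "\<dots> = wsum x (S n x) (\<lambda>y. ennreal \<bar>f y\<bar>)"
    using wsum_tree_finite[OF M f] by (intro wsum_eq_rsum[OF M root, symmetric]) auto
  also have "\<dots> \<le> (\<Sum>k\<le>height (\<tau> n). (transfer ^^ k) (\<lambda>y. ennreal \<bar>f y\<bar>) x)"
    by (rule wsum_rooted_le[OF M root])
  finally show ?thesis by (simp add: lessThan_Suc_atMost)
qed

text \<open>
  The weighted sums stay bounded by \<open>2 C\<close>, while fatness and the growth of the heights make the
  weights tend to infinity.
\<close>
lemma avg_coboundary_tendsto_0:
  assumes x: "regular x" and g: "\<And>y. \<bar>g y\<bar> \<le> C"
  shows "(\<lambda>n. avg n (\<lambda>y. g y - g (T y)) x) \<longlonglongrightarrow> 0"
proof (rule Lim_null_comparison)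
  note M = regularD(1)[OF x]
  have "0 \<le> C" using g[of x] by linarith
  show "\<forall>\<^sub>F n in sequentially. norm (avg n (\<lambda>y. g y - g (T y)) x) \<le> (2 * C / c) / (real (height (\<tau> n)) + 1)"
  proof (rule always_eventually, rule allI)
    fix n
    note root = rooted_tree[OF M, of n]
    have sub: "transfer (\<lambda>_. 1) z \<le> 1" if "z \<in> S n x" for z
      using that x root by (auto simp: regular_def rooted_def)
    have int: "integrable (count_space (S n x)) (\<lambda>y. g y * \<rho> x y)"
      "integrable (count_space (S n x)) (\<lambda>y. g (T y) * \<rho> x y)"
      using g by (auto intro!: integrable_tree M summable_at_bounded[OF x, of _ C])
    have "rsum x (S n x) (\<lambda>y. g y - g (T y)) = rsum x (S n x) g - rsum x (S n x) (\<lambda>y. g (T y))"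
      unfolding rsum_def left_diff_distrib using int by simp
    with rsum_coboundary_bound[OF M root sub _ g] tree_weight(3)[OF x, of n]
    have "\<bar>rsum x (S n x) (\<lambda>y. g y - g (T y))\<bar> \<le> 2 * C" by simp
    then have "norm (avg n (\<lambda>y. g y - g (T y)) x) \<le> 2 * C / W n x"
      using tree_weight(2)[OF x, of n] by (simp add: avg_eq[OF x] abs_divide divide_right_mono)
    also have "\<dots> \<le> 2 * C / (c * (real (height (\<tau> n)) + 1))"
      using tree_weight(1,2)[OF x, of n] c_pos \<open>0 \<le> C\<close>
      by (intro divide_left_mono) (auto intro!: mult_pos_pos)
    finally show "norm (avg n (\<lambda>y. g y - g (T y)) x) \<le> (2 * C / c) / (real (height (\<tau> n)) + 1)"
      by simp
  qed
  have "filterlim (\<lambda>n. real (height (\<tau> n)) + 1) at_top sequentially"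
    by (rule filterlim_at_top_mono[OF filterlim_compose[OF filterlim_real_sequentially heights]]) simp
  then show "(\<lambda>n. (2 * C / c) / (real (height (\<tau> n)) + 1)) \<longlonglongrightarrow> 0"
    by (rule tendsto_divide_0[OF tendsto_const filterlim_at_top_imp_at_infinity])
qed

text \<open>
  Split \<open>f\<close> into its conditional expectation, a bounded coboundary and a remainder \<open>r\<close> that is small
  in \<open>L\<^sup>1\<close>. The first is averaged to itself, the averages of the second tend to \<open>0\<close>, and those of
  the third are at most \<open>a / c\<close> off the set where the maximal function of \<open>\<bar>r\<bar>\<close> exceeds \<open>a\<close>.
\<close>
lemma AE_avg_approx_off_small_set:
  assumes f: "integrable M f" and "a > 0" "e > 0"
  shows "\<exists>B\<in>sets M. emeasure M B \<le> ennreal e \<and>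
    (AE x in M. x \<notin> B \<longrightarrow> (\<forall>\<^sub>F n in sequentially. \<bar>avg n f x - real_cond_exp M Inv f x\<bar> < 2 * a / c))"
proof -
  let ?E = "real_cond_exp M Inv f"
  obtain g r and C :: real where g: "g \<in> borel_measurable M" "\<And>x. \<bar>g x\<bar> \<le> C"
    and r: "integrable M r" "(\<integral>x. \<bar>r x\<bar> \<partial>M) < a * e"
    and dec: "\<And>x. f x = ?E x + (g x - g (T x)) + r x"
    using invariant_plus_coboundary_dense[OF f, of "a * e"] assms(2,3) by (metis mult_pos_pos)
  have [measurable]: "r \<in> borel_measurable M" using r(1) by simp
  \<comment> \<open>where the maximal function of \<open>\<bar>r\<bar>\<close> exceeds \<open>a\<close>\<close>
  define B where "B = {x\<in>space M. \<exists>n. of_nat n * ennreal a < (\<Sum>k<n. (transfer ^^ k) (\<lambda>x. ennreal \<bar>r x\<bar>) x)}"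
  have "B \<in> sets M" unfolding B_def by measurable
  moreover have "emeasure M B \<le> ennreal e"
  proof -
    have nn: "(\<integral>\<^sup>+x. ennreal \<bar>r x\<bar> \<partial>M) = ennreal (\<integral>x. \<bar>r x\<bar> \<partial>M)"
      by (rule nn_integral_eq_integral) (use r(1) in auto)
    have "ennreal a * emeasure M B \<le> (\<integral>\<^sup>+x. ennreal \<bar>r x\<bar> \<partial>M)"
      unfolding B_def by (rule transfer_maximal_inequality) (simp_all add: nn)
    also have "\<dots> \<le> ennreal (a * e)" unfolding nn using r(2) by (intro ennreal_leI) simp
    finally have "ennreal (a * measure M B) \<le> ennreal (a * e)"
      using \<open>a > 0\<close> by (simp add: emeasure_eq_measure ennreal_mult)
    then show ?thesis using assms(2,3) by (simp add: emeasure_eq_measure ennreal_le_iff)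
  qed
  moreover have "AE x in M. x \<notin> B \<longrightarrow> (\<forall>\<^sub>F n in sequentially. \<bar>avg n f x - ?E x\<bar> < 2 * a / c)"
    using AE_regular AE_summable_at[OF r(1)]
  proof eventually_elim
    case (elim x)
    note M = regularD(1)[OF elim(1)]
    show ?case
    proof
      assume "x \<notin> B"
      have small: "\<bar>avg n r x\<bar> \<le> a / c" for n
      proof -
        let ?h = "real (height (\<tau> n)) + 1"
        have "ennreal (c * ?h) * ennreal (avg n (\<lambda>y. \<bar>r y\<bar>) x)
            \<le> (\<Sum>k<Suc (height (\<tau> n)). (transfer ^^ k) (\<lambda>y. ennreal \<bar>r y\<bar>) x)"
          by (rule avg_abs_le_transfer[OF elim])
        also have "\<dots> \<le> of_nat (Suc (height (\<tau> n))) * ennreal a"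
          using \<open>x \<notin> B\<close> M unfolding B_def by (simp only: mem_Collect_eq) (meson linorder_not_le)
        also have "\<dots> = ennreal (?h * a)"
          using \<open>a > 0\<close> by (simp add: ennreal_of_nat_eq_real_of_nat ennreal_mult add.commute del: of_nat_Suc) simp
        finally have "ennreal (c * ?h * avg n (\<lambda>y. \<bar>r y\<bar>) x) \<le> ennreal (?h * a)"
          using c_pos by (simp add: ennreal_mult')
        then have "c * ?h * avg n (\<lambda>y. \<bar>r y\<bar>) x \<le> ?h * a"
          using \<open>a > 0\<close> by (simp add: ennreal_le_iff)
        then have "?h * (c * avg n (\<lambda>y. \<bar>r y\<bar>) x) \<le> ?h * a" by (simp add: ac_simps)
        then have "c * avg n (\<lambda>y. \<bar>r y\<bar>) x \<le> a" by (rule mult_left_le_imp_le) simp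
        then have "avg n (\<lambda>y. \<bar>r y\<bar>) x \<le> a / c" using c_pos by (simp add: pos_le_divide_eq mult.commute)
        with avg_abs_le[OF elim(1), of n r] show ?thesis by (rule order_trans)
      qed
      have inv: "?E (T y) = ?E y" if "y \<in> space M" for y
        by (rule Inv_measurable_invariant[OF _ that]) simp
      note Einv = avg_invariant[OF elim(1), of ?E, OF inv]
      have "\<bar>g y - g (T y)\<bar> \<le> 2 * C" for y using g(2)[of y] g(2)[of "T y"] by linarith
      then have sum_g: "summable_at (\<lambda>y. g y - g (T y)) x" by (rule summable_at_bounded[OF elim(1)])
      have sum_Eg: "summable_at (\<lambda>y. ?E y + (g y - g (T y))) x"
        by (rule summable_at_add[OF M Einv(2) sum_g])
      have "avg n f x = ?E x + avg n (\<lambda>y. g y - g (T y)) x + avg n r x" for n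
      proof -
        have "avg n f x = avg n (\<lambda>y. (?E y + (g y - g (T y))) + r y) x"
          by (rule avg_cong) (rule dec)
        then show ?thesis
          using Einv by (simp add: avg_add[OF elim(1)] sum_Eg sum_g elim(2))
      qed
      then have eq: "avg n f x - ?E x = avg n (\<lambda>y. g y - g (T y)) x + avg n r x" for n by simp
      have "\<forall>\<^sub>F n in sequentially. \<bar>avg n (\<lambda>y. g y - g (T y)) x\<bar> < a / c"
        using avg_coboundary_tendsto_0[OF elim(1) g(2)] assms(2) c_pos
        by (intro order_tendstoD(2)[OF tendsto_rabs_zero]) auto
      then show "\<forall>\<^sub>F n in sequentially. \<bar>avg n f x - ?E x\<bar> < 2 * a / c"
      proof eventually_elim
        case (elim n)
        have "2 * a / c = a / c + a / c" by simp
        with elim small[of n] show ?case unfolding eq by linarith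
      qed
    qed
  qed
  ultimately show ?thesis by blast
qed

text \<open>For each accuracy the exceptional sets can be made arbitrarily small, so their intersection is null.\<close>
lemma AE_avg_tendsto:
  assumes f: "integrable M f"
  shows "AE x in M. (\<lambda>n. avg n f x) \<longlonglongrightarrow> real_cond_exp M Inv f x"
proof -
  let ?E = "real_cond_exp M Inv f"
  let ?P = "\<lambda>a x. \<forall>\<^sub>F n in sequentially. \<bar>avg n f x - ?E x\<bar> < 2 * a / c"
  have ae: "AE x in M. ?P a x" if "a > 0" for a
  proof -
    let ?Q = "\<lambda>j B. B \<in> sets M \<and> emeasure M B \<le> ennreal (inverse (real (Suc j))) \<and>
      (AE x in M. x \<notin> B \<longrightarrow> ?P a x)"
    have "\<exists>B. ?Q j B" for j
      using AE_avg_approx_off_small_set[OF f that, of "inverse (real (Suc j))"] unfolding Bex_def by simp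
    then obtain B where "\<forall>j. ?Q j (B j)" using choice[of ?Q] by blast
    then have B: "\<And>j. B j \<in> sets M" "\<And>j. emeasure M (B j) \<le> ennreal (inverse (real (Suc j)))"
      "\<And>j. AE x in M. x \<notin> B j \<longrightarrow> ?P a x"
      by simp_all
    have meas: "(\<Inter>j. B j) \<in> sets M" using B(1) by auto
    have "emeasure M (\<Inter>j. B j) \<le> ennreal (inverse (real (Suc j)))" for j
      using B(1,2) by (intro order_trans[OF emeasure_mono[of "\<Inter>j. B j" "B j"]]) auto
    then have "emeasure M (\<Inter>j. B j) \<le> ennreal 0"
      by (intro LIMSEQ_le_const[OF tendsto_ennrealI[OF LIMSEQ_inverse_real_of_nat]]) auto
    then have "AE x in M. x \<notin> (\<Inter>j. B j)" using meas by (intro AE_not_in) (auto simp: null_sets_def)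
    moreover have "AE x in M. \<forall>j. x \<notin> B j \<longrightarrow> ?P a x" unfolding AE_all_countable using B(3) by blast
    ultimately show ?thesis by eventually_elim auto
  qed
  have "AE x in M. \<forall>j. ?P (inverse (real (Suc j))) x"
    unfolding AE_all_countable using ae by auto
  then show ?thesis
  proof eventually_elim
    case (elim x)
    show ?case
    proof (rule tendstoI)
      fix e :: real assume "e > 0"
      then have "0 < c * e / 2" using c_pos by simp
      then obtain j where j: "inverse (real (Suc j)) < c * e / 2" using reals_Archimedean by blast
      have "2 * inverse (real (Suc j)) / c < e" using j c_pos by (simp add: pos_divide_less_eq mult.commute)
      with elim[rule_format, of j] show "\<forall>\<^sub>F n in sequentially. dist (avg n f x) (?E x) < e"
        by (auto simp: dist_real_def elim!: eventually_mono)
    qed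
  qed
qed

end

section \<open>Averages over fat trees: convergence in the mean\<close>

context fat_tree_sequence
begin

lemma avg_cmult:
  assumes "regular x"
  shows "avg n (\<lambda>y. C * f y) x = C * avg n f x"
  by (simp add: avg_eq[OF assms] rsum_def mult.assoc)

lemma summable_at_cmult:
  assumes "x \<in> space M" "summable_at f x"
  shows "summable_at (\<lambda>y. C * f y) x"
  unfolding summable_at_def
proof
  fix k
  have "(transfer ^^ k) (\<lambda>y. ennreal \<bar>C * f y\<bar>) x = ennreal \<bar>C\<bar> * (transfer ^^ k) (\<lambda>y. ennreal \<bar>f y\<bar>) x"
    unfolding transfer_power_eq_wsum[OF assms(1)] wsum_def
    by (simp add: nn_integral_cmult[symmetric] abs_mult ennreal_mult mult.left_commute)
  also have "\<dots> < \<infinity>" using assms(2) by (simp add: summable_at_def ennreal_mult_less_top)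
  finally show "(transfer ^^ k) (\<lambda>y. ennreal \<bar>C * f y\<bar>) x < \<infinity>" .
qed

text \<open>
  Jensen's inequality: average the tangent of \<open>t \<mapsto> t\<^sup>p\<close> at the mean \<open>a\<close> of \<open>\<bar>f\<bar>\<close>.
\<close>
lemma avg_powr_le:
  assumes x: "regular x" and f: "summable_at f x" "summable_at (\<lambda>y. \<bar>f y\<bar> powr p) x" and p: "1 \<le> p"
  shows "\<bar>avg n f x\<bar> powr p \<le> avg n (\<lambda>y. \<bar>f y\<bar> powr p) x"
proof -
  note M = regularD(1)[OF x]
  define a where "a = avg n (\<lambda>y. \<bar>f y\<bar>) x"
  define L where "L = p * a powr (p - 1)"
  have f': "summable_at (\<lambda>y. \<bar>f y\<bar>) x" by (rule summable_at_mono[OF f(1) _ M]) simp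
  have le_a: "\<bar>avg n f x\<bar> \<le> a" unfolding a_def by (rule avg_abs_le[OF x])
  then have a: "0 \<le> a" by linarith
  have "\<bar>avg n f x\<bar> powr p \<le> a powr p" using le_a p by (intro powr_mono2) auto
  also have "\<dots> = (a powr p - L * a) + L * avg n (\<lambda>y. \<bar>f y\<bar>) x" by (simp add: a_def)
  also have "\<dots> = avg n (\<lambda>y. (a powr p - L * a) + L * \<bar>f y\<bar>) x"
    by (simp only: avg_add[OF x regularD(2)[OF x] summable_at_cmult[OF M f']] avg_const[OF x] avg_cmult[OF x])
  also have "\<dots> \<le> avg n (\<lambda>y. \<bar>f y\<bar> powr p) x"
  proof (rule avg_mono[OF x _ f(2)])
    show "summable_at (\<lambda>y. (a powr p - L * a) + L * \<bar>f y\<bar>) x"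
      by (rule summable_at_add[OF M regularD(2)[OF x] summable_at_cmult[OF M f']])
    show "(a powr p - L * a) + L * \<bar>f y\<bar> \<le> \<bar>f y\<bar> powr p" for y
      using powr_above_tangent[OF p a, of "\<bar>f y\<bar>"] by (simp add: L_def algebra_simps)
  qed
  finally show ?thesis .
qed

text \<open>
  By Jensen's inequality and fatness, the \<open>p\<close>-th power of the average is at most \<open>1 / c\<close> times the
  mean of \<open>transfer\<^sup>k \<bar>f\<bar>\<^sup>p\<close> over the generations \<open>k\<close>, and the transfer operator preserves integrals.
\<close>
lemma nn_integral_avg_powr_le:
  assumes f: "f \<in> Lp M p" and p: "1 \<le> p"
  shows "(\<integral>\<^sup>+x. ennreal (\<bar>avg n f x\<bar> powr p) \<partial>M) \<le> ennreal ((\<integral>x. \<bar>f x\<bar> powr p \<partial>M) / c)"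
proof -
  have [measurable]: "f \<in> borel_measurable M" and int: "integrable M (\<lambda>x. \<bar>f x\<bar> powr p)"
    using f by (auto simp: Lp_def)
  have [measurable]: "avg n f \<in> borel_measurable M" by (rule word_average_measurable[OF trees]) simp
  let ?h = "real (height (\<tau> n)) + 1"
  let ?F = "\<lambda>x. ennreal (\<bar>f x\<bar> powr p)"
  have f_int: "integrable M f" by (rule Lp_integrable[OF finite_measure_axioms f p])
  have "ennreal (c * ?h) * (\<integral>\<^sup>+x. ennreal (\<bar>avg n f x\<bar> powr p) \<partial>M)
      = (\<integral>\<^sup>+x. ennreal (c * ?h) * ennreal (\<bar>avg n f x\<bar> powr p) \<partial>M)"
    by (rule nn_integral_cmult[symmetric]) measurable
  also have "\<dots> \<le> (\<integral>\<^sup>+x. (\<Sum>k<Suc (height (\<tau> n)). (transfer ^^ k) ?F x) \<partial>M)"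
  proof (rule nn_integral_mono_AE)
    show "AE x in M. ennreal (c * ?h) * ennreal (\<bar>avg n f x\<bar> powr p)
        \<le> (\<Sum>k<Suc (height (\<tau> n)). (transfer ^^ k) ?F x)"
      using AE_regular AE_summable_at[OF f_int] AE_summable_at[OF int]
    proof eventually_elim
      case (elim x)
      have "ennreal (c * ?h) * ennreal (\<bar>avg n f x\<bar> powr p)
          \<le> ennreal (c * ?h) * ennreal (avg n (\<lambda>y. \<bar>f y\<bar> powr p) x)"
        by (intro mult_left_mono ennreal_leI avg_powr_le[OF elim p]) simp
      also have "\<dots> \<le> (\<Sum>k<Suc (height (\<tau> n)). (transfer ^^ k) ?F x)"
        using avg_abs_le_transfer[OF elim(1,3), of n] by simp
      finally show ?case .
    qed
  qed
  also have "\<dots> = (\<Sum>k<Suc (height (\<tau> n)). \<integral>\<^sup>+x. (transfer ^^ k) ?F x \<partial>M)"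
    by (rule nn_integral_sum) measurable
  also have "\<dots> = (\<Sum>k<Suc (height (\<tau> n)). ennreal (\<integral>x. \<bar>f x\<bar> powr p \<partial>M))"
    by (intro sum.cong refl) (simp add: nn_integral_transfer_pow nn_integral_eq_integral[OF int])
  also have "\<dots> = ennreal (?h * (\<integral>x. \<bar>f x\<bar> powr p \<partial>M))"
    by (simp add: ennreal_of_nat_eq_real_of_nat ennreal_mult' add.commute del: sum.lessThan_Suc)
  also have "\<dots> = ennreal (c * ?h) * ennreal ((\<integral>x. \<bar>f x\<bar> powr p \<partial>M) / c)"
    using c_pos by (simp add: ennreal_mult[symmetric] ac_simps)
  finally show ?thesis
    using c_pos by (subst (asm) ennreal_mult_le_mult_iff) (auto simp: mult_pos_pos)
qed

lemma avg_Lp: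
  assumes f: "f \<in> Lp M p" and p: "1 \<le> p"
  shows "integrable M (\<lambda>x. \<bar>avg n f x\<bar> powr p)"
    "(\<integral>x. \<bar>avg n f x\<bar> powr p \<partial>M) \<le> (\<integral>x. \<bar>f x\<bar> powr p \<partial>M) / c"
proof -
  have [measurable]: "avg n f \<in> borel_measurable M"
    by (rule word_average_measurable[OF trees]) (use f in \<open>simp add: Lp_def\<close>)
  show int: "integrable M (\<lambda>x. \<bar>avg n f x\<bar> powr p)"
    using nn_integral_avg_powr_le[OF f p, of n]
    by (intro integrableI_bounded) (auto intro: le_less_trans)
  show "(\<integral>x. \<bar>avg n f x\<bar> powr p \<partial>M) \<le> (\<integral>x. \<bar>f x\<bar> powr p \<partial>M) / c"
    using nn_integral_avg_powr_le[OF f p, of n] c_pos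
    by (simp add: nn_integral_eq_integral[OF int] ennreal_le_iff integral_nonneg_AE)
qed

text \<open>The bound for the averages passes to their almost everywhere limit by Fatou's lemma.\<close>
lemma cond_exp_Lp:
  assumes f: "f \<in> Lp M p" and p: "1 \<le> p"
  shows "integrable M (\<lambda>x. \<bar>real_cond_exp M Inv f x\<bar> powr p)"
    "(\<integral>x. \<bar>real_cond_exp M Inv f x\<bar> powr p \<partial>M) \<le> (\<integral>x. \<bar>f x\<bar> powr p \<partial>M) / c"
proof -
  let ?E = "real_cond_exp M Inv f"
  have [measurable]: "avg n f \<in> borel_measurable M" for n
    by (rule word_average_measurable[OF trees]) (use f in \<open>simp add: Lp_def\<close>)
  have "(\<integral>\<^sup>+x. ennreal (\<bar>?E x\<bar> powr p) \<partial>M) = (\<integral>\<^sup>+x. liminf (\<lambda>n. ennreal (\<bar>avg n f x\<bar> powr p)) \<partial>M)"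
  proof (rule nn_integral_cong_AE)
    show "AE x in M. ennreal (\<bar>?E x\<bar> powr p) = liminf (\<lambda>n. ennreal (\<bar>avg n f x\<bar> powr p))"
      using AE_avg_tendsto[OF Lp_integrable[OF finite_measure_axioms f p]]
    proof eventually_elim
      case (elim x)
      have "(\<lambda>n. \<bar>avg n f x\<bar> powr p) \<longlonglongrightarrow> \<bar>?E x\<bar> powr p"
        using p by (intro tendsto_powr' tendsto_rabs elim tendsto_const) auto
      from lim_imp_Liminf[OF _ tendsto_ennrealI[OF this]] show ?case by simp
    qed
  qed
  also have "\<dots> \<le> liminf (\<lambda>n. \<integral>\<^sup>+x. ennreal (\<bar>avg n f x\<bar> powr p) \<partial>M)"
    by (rule nn_integral_liminf) measurable
  also have "\<dots> \<le> liminf (\<lambda>n::nat. ennreal ((\<integral>x. \<bar>f x\<bar> powr p \<partial>M) / c))"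
    by (intro Liminf_mono always_eventually allI nn_integral_avg_powr_le f p)
  finally have le: "(\<integral>\<^sup>+x. ennreal (\<bar>?E x\<bar> powr p) \<partial>M) \<le> ennreal ((\<integral>x. \<bar>f x\<bar> powr p \<partial>M) / c)"
    by (simp add: Liminf_const)
  show int: "integrable M (\<lambda>x. \<bar>?E x\<bar> powr p)"
    using le by (intro integrableI_bounded) (auto intro: le_less_trans)
  show "(\<integral>x. \<bar>?E x\<bar> powr p \<partial>M) \<le> (\<integral>x. \<bar>f x\<bar> powr p \<partial>M) / c"
    using le c_pos by (simp add: nn_integral_eq_integral[OF int] ennreal_le_iff integral_nonneg_AE)
qed

lemma Lp_error_bounded:
  assumes [measurable]: "u \<in> borel_measurable M" and u: "\<And>x. \<bar>u x\<bar> \<le> C" and p: "1 \<le> p"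
  shows "(\<lambda>n. \<integral>x. \<bar>avg n u x - real_cond_exp M Inv u x\<bar> powr p \<partial>M) \<longlonglongrightarrow> 0"
    "\<And>n. integrable M (\<lambda>x. \<bar>avg n u x - real_cond_exp M Inv u x\<bar> powr p)"
proof -
  let ?E = "real_cond_exp M Inv u"
  have u_int: "integrable M u" by (rule integrable_const_bound[where B = C]) (use u in auto)
  have [measurable]: "avg n u \<in> borel_measurable M" for n
    by (rule word_average_measurable[OF trees]) simp
  note lim = AE_avg_tendsto[OF u_int]
  have bound: "AE x in M. norm (\<bar>avg n u x - ?E x\<bar> powr p) \<le> (2 * C) powr p" for n
    using AE_regular lim
  proof eventually_elim
    case (elim x)
    have avg: "\<bar>avg n u x\<bar> \<le> C" for n
    proof -
      have "\<bar>avg n u x\<bar> \<le> avg n (\<lambda>y. \<bar>u y\<bar>) x" by (rule avg_abs_le[OF elim(1)])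
      also have "\<dots> \<le> avg n (\<lambda>_. C) x"
        using u by (intro avg_mono elim summable_at_bounded[OF elim(1), of _ C] regularD) auto
      finally show ?thesis by (simp add: avg_const[OF elim(1)])
    qed
    have "\<bar>?E x\<bar> \<le> C"
      by (rule LIMSEQ_le_const2[OF tendsto_rabs[OF elim(2)]]) (auto simp: avg)
    with avg[of n] have "\<bar>avg n u x - ?E x\<bar> \<le> 2 * C" by linarith
    then show ?case using p by (auto intro!: powr_mono2)
  qed
  show "integrable M (\<lambda>x. \<bar>avg n u x - ?E x\<bar> powr p)" for n
    by (rule integrable_const_bound[OF bound]) measurable
  have "(\<lambda>n. \<integral>x. \<bar>avg n u x - ?E x\<bar> powr p \<partial>M) \<longlonglongrightarrow> (\<integral>x. 0 \<partial>M)"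
  proof (rule integral_dominated_convergence[where w = "\<lambda>_. (2 * C) powr p"])
    show "AE x in M. (\<lambda>n. \<bar>avg n u x - ?E x\<bar> powr p) \<longlonglongrightarrow> 0"
      using lim
    proof eventually_elim
      case (elim x)
      show ?case
        using p by (intro tendsto_zero_powrI tendsto_rabs_zero LIM_zero elim tendsto_const) auto
    qed
  qed (use bound in auto)
  then show "(\<lambda>n. \<integral>x. \<bar>avg n u x - ?E x\<bar> powr p \<partial>M) \<longlonglongrightarrow> 0" by simp
qed

text \<open>
  Split \<open>f = u + v\<close> with \<open>u\<close> bounded and \<open>v\<close> small in \<open>L\<^sup>p\<close>. The error for \<open>u\<close> tends to \<open>0\<close>; the average
  and the conditional expectation of \<open>v\<close> stay small uniformly in \<open>n\<close>.
\<close>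
lemma Lp_error_tendsto:
  assumes f: "f \<in> Lp M p" and p: "1 \<le> p"
  shows "(\<lambda>n. \<integral>x. \<bar>avg n f x - real_cond_exp M Inv f x\<bar> powr p \<partial>M) \<longlonglongrightarrow> 0"
proof (rule tendstoI)
  fix e :: real assume "e > 0"
  let ?E = "real_cond_exp M Inv"
  have [measurable]: "f \<in> borel_measurable M" and f_p: "integrable M (\<lambda>x. \<bar>f x\<bar> powr p)"
    using f by (auto simp: Lp_def)
  have f_int: "integrable M f" by (rule Lp_integrable[OF finite_measure_axioms f p])
  \<comment> \<open>chosen so that the three error terms below, with the factor \<open>3\<^sup>p\<close>, add up to \<open>e\<close>\<close>
  define e' where "e' = e / (3 powr p * (1 + 2 / c))"
  have e': "e' > 0" using \<open>e > 0\<close> c_pos by (simp add: e'_def add_pos_pos)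
  have "\<forall>\<^sub>F K in sequentially. (\<integral>x. \<bar>f x - truncate K (f x)\<bar> powr p \<partial>M) < e'"
    using p e' by (intro order_tendstoD(2)[OF truncate_tendsto_Lp] f_p) auto
  then obtain K where K: "(\<integral>x. \<bar>f x - truncate K (f x)\<bar> powr p \<partial>M) < e'"
    by (auto simp: eventually_sequentially)
  define u where "u x = truncate K (f x)" for x
  define v where "v x = f x - u x" for x
  have u_meas [measurable]: "u \<in> borel_measurable M" unfolding u_def truncate_def by measurable
  have [measurable]: "v \<in> borel_measurable M" unfolding v_def by measurable
  have u: "\<bar>u x\<bar> \<le> real K" for x by (simp add: u_def abs_truncate_le)
  have u_int: "integrable M u" by (rule integrable_const_bound[where B = "real K"]) (use u in auto)
  have v: "v \<in> Lp M p"
  proof -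
    have "integrable M (\<lambda>x. \<bar>v x\<bar> powr p)"
    proof (rule Bochner_Integration.integrable_bound[OF f_p])
      show "AE x in M. norm (\<bar>v x\<bar> powr p) \<le> norm (\<bar>f x\<bar> powr p)"
        using p by (auto simp: v_def u_def intro!: powr_mono2 abs_diff_truncate_le)
    qed simp
    then show ?thesis by (simp add: Lp_def)
  qed
  have v_int: "integrable M v" by (rule Lp_integrable[OF finite_measure_axioms v p])
  have v_small: "(\<integral>x. \<bar>v x\<bar> powr p \<partial>M) < e'" using K by (simp add: v_def u_def)
  note uE = Lp_error_bounded[OF u_meas u p]
  have "\<forall>\<^sub>F n in sequentially. (\<integral>x. \<bar>avg n u x - ?E u x\<bar> powr p \<partial>M) < e'"
    using e' by (intro order_tendstoD(2)[OF uE(1)]) auto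
  then show "\<forall>\<^sub>F n in sequentially. dist (\<integral>x. \<bar>avg n f x - ?E f x\<bar> powr p \<partial>M) 0 < e"
  proof eventually_elim
    case (elim n)
    have [measurable]: "avg n f \<in> borel_measurable M" by (rule word_average_measurable[OF trees]) simp
    have E_add: "AE x in M. ?E (\<lambda>x. u x + v x) x = ?E u x + ?E v x"
      by (rule inv.real_cond_exp_add[OF u_int v_int])
    have uv: "(\<lambda>x. u x + v x) = f" by (simp add: v_def)
    let ?G = "\<lambda>x. 3 powr p * (\<bar>avg n u x - ?E u x\<bar> powr p + \<bar>avg n v x\<bar> powr p + \<bar>?E v x\<bar> powr p)"
    have int: "integrable M ?G"
      using uE(2)[of n] avg_Lp(1)[OF v p, of n] cond_exp_Lp(1)[OF v p] by simp
    have le: "AE x in M. \<bar>avg n f x - ?E f x\<bar> powr p \<le> ?G x"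
      using AE_regular AE_summable_at[OF u_int] AE_summable_at[OF v_int] E_add
    proof eventually_elim
      case (elim x)
      have "avg n f x = avg n u x + avg n v x"
        using avg_add[OF elim(1-3), of n] by (simp add: uv)
      then have "avg n f x - ?E f x = (avg n u x - ?E u x) + avg n v x + (- ?E v x)"
        using elim(4) by (simp add: uv)
      then show ?case
        using abs_add3_powr_le[of p "avg n u x - ?E u x" "avg n v x" "- ?E v x"] p by simp
    qed
    have "(\<integral>x. \<bar>avg n f x - ?E f x\<bar> powr p \<partial>M) \<le> (\<integral>x. ?G x \<partial>M)"
    proof (rule integral_mono_AE[OF _ int le])
      show "integrable M (\<lambda>x. \<bar>avg n f x - ?E f x\<bar> powr p)"
        by (rule Bochner_Integration.integrable_bound[OF int]) (use le in \<open>auto elim!: eventually_mono\<close>)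
    qed
    also have "\<dots> = 3 powr p * ((\<integral>x. \<bar>avg n u x - ?E u x\<bar> powr p \<partial>M)
        + (\<integral>x. \<bar>avg n v x\<bar> powr p \<partial>M) + (\<integral>x. \<bar>?E v x\<bar> powr p \<partial>M))"
      using uE(2)[of n] avg_Lp(1)[OF v p, of n] cond_exp_Lp(1)[OF v p] by simp
    also have "\<dots> < 3 powr p * (e' + e' / c + e' / c)"
    proof (rule mult_strict_left_mono)
      have "(\<integral>x. \<bar>v x\<bar> powr p \<partial>M) / c < e' / c" using v_small c_pos by (simp add: divide_strict_right_mono)
      with elim avg_Lp(2)[OF v p, of n] cond_exp_Lp(2)[OF v p]
      show "(\<integral>x. \<bar>avg n u x - ?E u x\<bar> powr p \<partial>M) + (\<integral>x. \<bar>avg n v x\<bar> powr p \<partial>M)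
        + (\<integral>x. \<bar>?E v x\<bar> powr p \<partial>M) < e' + e' / c + e' / c"
        by linarith
    qed simp
    also have "\<dots> = 3 powr p * (1 + 2 / c) * e'" by (simp add: field_simps)
    also have "\<dots> = e"
    proof -
      have "3 powr p * (1 + 2 / c) \<noteq> 0" using c_pos by (simp add: add_pos_pos less_imp_neq[symmetric])
      then show ?thesis by (simp add: e'_def)
    qed
    finally show ?case by (simp add: integral_nonneg_AE)
  qed
qed

lemma tendsto_Lp_avg:
  assumes f: "f \<in> Lp M p" and p: "1 \<le> p"
  shows "tendsto_Lp M p (\<lambda>n. avg n f) (real_cond_exp M Inv f)"
  unfolding tendsto_Lp_def
proof (intro conjI allI)
  show "avg n f \<in> Lp M p" for n
    using avg_Lp(1)[OF f p] word_average_measurable[OF trees] f by (simp add: Lp_def)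
  show "real_cond_exp M Inv f \<in> Lp M p"
    using cond_exp_Lp(1)[OF f p] by (simp add: Lp_def)
  show "(\<lambda>n. Lp_norm M p (\<lambda>x. avg n f x - real_cond_exp M Inv f x)) \<longlonglongrightarrow> 0"
    unfolding Lp_norm_def using p
    by (intro tendsto_zero_powrI[OF Lp_error_tendsto[OF f p] tendsto_const])
       (auto simp: integral_nonneg_AE)
qed

end

theorem corollary4p15:
  fixes M :: "'a measure" and T :: "'a \<Rightarrow> 'a" and \<rho> :: "'a \<Rightarrow> 'a \<Rightarrow> real"
    and \<Gamma> :: "('a \<rightharpoonup> 'a) set" and c p :: real
    and \<tau> :: "nat \<Rightarrow> ('a \<rightharpoonup> 'a) list set" and f :: "'a \<Rightarrow> real"
  assumes "prob_space M" and "standard_borel M"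
    and "measure_preserving_map M T" and "aperiodic M T" and "countable_to_one M T"
    and "T ` space M = space M"
    and "null_preserving M (orbit_rel M T)"
    and "radon_nikodym_cocycle M (orbit_rel M T) \<rho>"
    and "countable \<Gamma>" and "complete_right_inverses M T \<Gamma>"
    and "c > 0"
    and "\<And>n. \<tau> n \<in> trees \<Gamma>" and "\<And>n. fat M \<rho> c (\<tau> n)"
    and "filterlim (\<lambda>n. height (\<tau> n)) at_top sequentially"
    and "1 \<le> p" and "f \<in> Lp M p"
  shows "(AE x in M. (\<lambda>n. word_average \<rho> (\<tau> n) f x)
            \<longlonglongrightarrow> real_cond_exp M (invariant_algebra M T) f x) \<and>
         tendsto_Lp M p (\<lambda>n. word_average \<rho> (\<tau> n) f) (real_cond_exp M (invariant_algebra M T) f)"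
proof -
  interpret prob_space M by fact
  interpret fat_tree_sequence M T \<rho> \<Gamma> c \<tau>
    by unfold_locales (use assms in auto)
  show ?thesis
    using AE_avg_tendsto[OF Lp_integrable[OF finite_measure_axioms assms(16,15)]]
      tendsto_Lp_avg[OF assms(16,15)] by blast
qed

end
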